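(* Let $H$ be a triangle-free graph on $h$ vertices. There exists a constant $\Lambda_H>0$ depending only on $H$ such that for every integer $q\geq 2$ and every integer $k\geq 100^h q^{4h^2}$, \[ r(H[k];q)\leq q^{\Lambda_H k}. \]
   Context: For a graph $H$ and a positive integer $k$, the blowup $H[k]$ is the graph obtained from $H$ by replacing every vertex by an independent set of size $k$ and every edge by a complete bipartite graph $K_{k,k}$. For a graph $F$ and an integer $q\geq 2$, the Ramsey number $r(F;q)$ is the least integer $N$ such that every coloring of the edges of the complete graph $K_N$ with $q$ colors contains a monochromatic copy of $F$. *)

theory Defs
  imports Complex_Main
begin

definition simple_graph :: "'a set \<Rightarrow> ('a \<Rightarrow> 'a \<Rightarrow> bool) \<Rightarrow> bool" where
  "simple_graph V E \<longleftrightarrow> finite V \<and>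
     (\<forall>u v. E u v \<longrightarrow> u \<in> V \<and> v \<in> V) \<and>
     (\<forall>u v. E u v \<longrightarrow> E v u) \<and> (\<forall>v. \<not> E v v)"

definition triangle_free :: "'a set \<Rightarrow> ('a \<Rightarrow> 'a \<Rightarrow> bool) \<Rightarrow> bool" where
  "triangle_free V E \<longleftrightarrow>
     \<not> (\<exists>x\<in>V. \<exists>y\<in>V. \<exists>z\<in>V. E x y \<and> E y z \<and> E x z)"

definition blowup_vertices :: "'a set \<Rightarrow> nat \<Rightarrow> ('a \<times> nat) set" where
  "blowup_vertices V k = V \<times> {..<k}"

definition blowup_edges :: "('a \<Rightarrow> 'a \<Rightarrow> bool) \<Rightarrow> nat \<Rightarrow> ('a \<times> nat) \<Rightarrow> ('a \<times> nat) \<Rightarrow> bool" where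
  "blowup_edges E k x y \<longleftrightarrow> E (fst x) (fst y) \<and> snd x < k \<and> snd y < k"

definition edge_colouring :: "nat \<Rightarrow> nat \<Rightarrow> (nat \<Rightarrow> nat \<Rightarrow> nat) \<Rightarrow> bool" where
  "edge_colouring N q c \<longleftrightarrow>
     (\<forall>x<N. \<forall>y<N. x \<noteq> y \<longrightarrow> c x y = c y x \<and> c x y < q)"

definition mono_copy :: "'a set \<Rightarrow> ('a \<Rightarrow> 'a \<Rightarrow> bool) \<Rightarrow> nat \<Rightarrow> (nat \<Rightarrow> nat \<Rightarrow> nat) \<Rightarrow> bool" where
  "mono_copy V E N c \<longleftrightarrow>
     (\<exists>f col. inj_on f V \<and> f ` V \<subseteq> {..<N} \<and>
        (\<forall>u\<in>V. \<forall>v\<in>V. E u v \<longrightarrow> c (f u) (f v) = col))"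

definition ramsey_number :: "'a set \<Rightarrow> ('a \<Rightarrow> 'a \<Rightarrow> bool) \<Rightarrow> nat \<Rightarrow> nat" where
  "ramsey_number V E q =
     (LEAST N. \<forall>c. edge_colouring N q c \<longrightarrow> mono_copy V E N c)"

end

theory Submission
  imports Defs "HOL-Library.FuncSet" "HOL-Library.Disjoint_Sets"
begin

text \<open>
  Throughout, homomorphisms of the graph into a relation are partite: vertex \<open>v\<close> goes to a
  prescribed part \<open>Y v\<close>. Fix a vertex \<open>a\<close> and let \<open>I\<close> be its neighbourhood. As the graph is
  triangle-free, \<open>I\<close> is independent, so the extensions of a homomorphism \<open>\<omega>\<close> of the other
  vertices to \<open>I\<close> form a product set, the box of \<open>\<omega>\<close>.

  Positive density gives a blowup: choose \<open>k\<close> homomorphisms \<open>\<omega>\<close> of the vertices outside \<open>I\<close>,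
  with distinct images of \<open>a\<close>, whose boxes have a large intersection carrying a proportional
  share of homomorphisms of the graph without \<open>a\<close>. The intersection is again a box, every
  part shrinks only by a factor exponential in \<open>k\<close>, and one recurses without \<open>a\<close>.

  Some colour has positive density: build the graph vertex by vertex. To add \<open>a\<close>, keep for
  each colour a set \<open>Z\<close> to which every vertex of the current host set has large degree in that
  colour. If a dense colour does not extend to \<open>a\<close> inside its \<open>Z\<close>, some box is so sparse
  towards \<open>Z\<close> that passing to subsets of \<open>Z\<close> and of one side of the box increases the degree
  bound by a constant factor. Degrees being at most 1, this happens only polynomially many times
  in the number of colours.
\<close>

section \<open>Dependent choice with signed weights\<close>

text \<open>Convexity of the power function: sum its tangent at \<open>g\<close>, which Bernoulli's
  inequality places below the graph. The slope is nonnegative, so an average above \<open>g\<close>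
  only helps.\<close>

lemma sum_power_ge:
  fixes F :: "'v \<Rightarrow> real" and g :: real
  assumes "finite V" and g: "g > 0" and F: "\<And>v. v \<in> V \<Longrightarrow> F v \<ge> 0"
    and avg: "(\<Sum>v\<in>V. F v) \<ge> g * card V"
  shows "(\<Sum>v\<in>V. F v ^ k) \<ge> g ^ k * card V"
proof -
  have tangent: "x ^ k \<ge> g ^ k + real k * (g ^ k / g) * (x - g)" if "x \<ge> 0" for x
  proof -
    have "1 + real k * (x / g - 1) \<le> (1 + (x / g - 1)) ^ k"
      by (rule Bernoulli_inequality) (use that g in auto)
    then have "g ^ k * (1 + real k * (x / g - 1)) \<le> g ^ k * (x / g) ^ k"
      using g by (intro mult_left_mono) auto
    also have "\<dots> = x ^ k" using g by (simp add: power_divide)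
    also have "g ^ k * (1 + real k * (x / g - 1)) = g ^ k + real k * (g ^ k / g) * (x - g)"
      using g by (simp add: field_simps)
    finally show ?thesis by simp
  qed
  define c where "c = real k * (g ^ k / g)"
  have "g ^ k * card V \<le> g ^ k * card V + c * ((\<Sum>v\<in>V. F v) - g * card V)"
    using avg g by (auto simp: c_def)
  also have "\<dots> = (\<Sum>v\<in>V. g ^ k + c * (F v - g))"
    by (simp add: sum.distrib sum_distrib_left[symmetric] sum_subtractf algebra_simps)
  also have "\<dots> \<le> (\<Sum>v\<in>V. F v ^ k)"
    unfolding c_def by (intro sum_mono tangent F)
  finally show ?thesis .
qed

text \<open>Averaging when only an upper bound \<open>M\<close> for the number of terms is known;
  this suffices because \<open>c\<close> is positive.\<close>

lemma sum_pos_exists_ge: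
  fixes f :: "'w \<Rightarrow> real"
  assumes "finite \<Omega>" and "real (card \<Omega>) \<le> M" and "c > 0" and "c * M \<le> sum f \<Omega>" and "M > 0"
  shows "\<exists>\<omega>\<in>\<Omega>. f \<omega> \<ge> c"
proof (rule ccontr)
  assume "\<not> ?thesis"
  then have lt: "\<And>\<omega>. \<omega> \<in> \<Omega> \<Longrightarrow> f \<omega> < c" by force
  have ne: "\<Omega> \<noteq> {}" using assms by (metis mult_pos_pos not_less sum.empty)
  have "sum f \<Omega> < (\<Sum>\<omega>\<in>\<Omega>. c)" by (rule sum_strict_mono) (use assms ne lt in auto)
  also have "\<dots> = c * card \<Omega>" by simp
  also have "\<dots> \<le> c * M" using assms by (intro mult_left_mono) auto
  finally show False using assms by simp
qed

text \<open>The weighted sum equals its own average over the next choice of \<open>\<omega>\<close>, so a good choice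
  exists; the error term pays for excluding the fibres of \<open>pr\<close> already used.\<close>

lemma greedy_choice:
  fixes w F :: "'v \<Rightarrow> real" and X :: "'w \<Rightarrow> 'v \<Rightarrow> bool" and M m :: real
  assumes fin: "finite \<Omega>" "finite V" and M: "real (card \<Omega>) \<le> M" "M > 0"
    and F: "\<And>v. v \<in> V \<Longrightarrow> F v * M = card {\<omega>\<in>\<Omega>. X \<omega> v}"
    and w: "\<And>v. v \<in> V \<Longrightarrow> \<bar>w v\<bar> \<le> 1"
    and fibre: "\<And>x. real (card {\<omega>\<in>\<Omega>. pr \<omega> = x}) * m \<le> M" and m: "m > 0"
    and big: "(\<Sum>v\<in>V. w v * F v ^ k) > real k * real k * card V / m"
  shows "t \<le> k \<Longrightarrow> \<exists>A\<subseteq>\<Omega>. card A = t \<and> inj_on pr A \<and>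
     (\<Sum>v\<in>{v\<in>V. \<forall>\<omega>\<in>A. X \<omega> v}. w v * F v ^ (k - t))
       \<ge> (\<Sum>v\<in>V. w v * F v ^ k) - real t * real k * card V / m"
proof (induction t)
  case 0
  show ?case by (intro exI[of _ "{}"]) auto
next
  case (Suc t)
  then obtain A where A: "A \<subseteq> \<Omega>" "card A = t" "inj_on pr A"
    and sumA: "(\<Sum>v\<in>{v\<in>V. \<forall>\<omega>\<in>A. X \<omega> v}. w v * F v ^ (k - t))
       \<ge> (\<Sum>v\<in>V. w v * F v ^ k) - real t * real k * card V / m" (is "?\<Phi> \<ge> _")
    by auto
  have finA: "finite A" using A fin finite_subset by blast
  define C where "C = {v\<in>V. \<forall>\<omega>\<in>A. X \<omega> v}"
  define j where "j = k - Suc t"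
  have kt: "k - t = Suc j" using Suc.prems by (simp add: j_def)
  define \<phi> where "\<phi> \<omega> = (\<Sum>v\<in>{v\<in>C. X \<omega> v}. w v * F v ^ j)" for \<omega>
  have finC: "finite C" "C \<subseteq> V" using fin by (auto simp: C_def)
  have F01: "0 \<le> F v \<and> F v \<le> 1" if "v \<in> V" for v
  proof -
    have "card {\<omega>\<in>\<Omega>. X \<omega> v} \<le> card \<Omega>" using fin by (intro card_mono) auto
    then have "0 \<le> F v * M" "F v * M \<le> 1 * M" using F[OF that] M by auto
    then show ?thesis using M(2) by (simp add: zero_le_mult_iff)
  qed
  define Bad where "Bad = {\<omega>\<in>\<Omega>. pr \<omega> \<in> pr ` A}"
  \<comment> \<open>Each \<open>v\<close> in \<open>C\<close> occurs for \<open>F v * M\<close> of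
    the \<open>\<omega>\<close>, so averaging over the next choice raises the exponent from
    \<open>j\<close> back to \<open>Suc j = k - t\<close>.\<close>
  have total: "sum \<phi> \<Omega> = M * (\<Sum>v\<in>C. w v * F v ^ Suc j)"
  proof -
    have "sum \<phi> \<Omega> = (\<Sum>\<omega>\<in>\<Omega>. \<Sum>v\<in>C. if X \<omega> v then w v * F v ^ j else 0)"
      unfolding \<phi>_def using finC by (intro sum.cong refl sum.inter_filter) auto
    also have "\<dots> = (\<Sum>v\<in>C. \<Sum>\<omega>\<in>\<Omega>. if X \<omega> v then w v * F v ^ j else 0)"
      by (rule sum.swap)
    also have "\<dots> = (\<Sum>v\<in>C. \<Sum>\<omega>\<in>{\<omega>\<in>\<Omega>. X \<omega> v}. w v * F v ^ j)"
      using fin by (intro sum.cong refl sum.inter_filter[symmetric]) auto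
    also have "\<dots> = (\<Sum>v\<in>C. w v * F v ^ j * (F v * M))"
      using finC F by (intro sum.cong refl) (simp add: subset_iff)
    also have "\<dots> = M * (\<Sum>v\<in>C. w v * F v ^ Suc j)"
      by (simp add: sum_distrib_left algebra_simps)
    finally show ?thesis .
  qed
  \<comment> \<open>Weights may be negative, but an upper bound is enough, because only the
    contribution of \<open>Bad\<close> is subtracted.\<close>
  have \<phi>_le: "\<phi> \<omega> \<le> card V" for \<omega>
  proof -
    have "\<phi> \<omega> \<le> (\<Sum>v\<in>{v\<in>C. X \<omega> v}. 1)"
      unfolding \<phi>_def
    proof (rule sum_mono)
      fix v assume "v \<in> {v\<in>C. X \<omega> v}"
      then have v: "v \<in> V" using finC by auto
      have "w v * F v ^ j \<le> \<bar>w v\<bar> * F v ^ j" using F01[OF v] by (intro mult_right_mono) auto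
      also have "\<dots> \<le> 1 * 1"
        using F01[OF v] w[OF v] by (intro mult_mono power_le_one) auto
      finally show "w v * F v ^ j \<le> 1" by simp
    qed
    also have "\<dots> \<le> card V" using fin finC by (auto intro!: card_mono)
    finally show ?thesis .
  qed
  have Bad: "Bad = (\<Union>x\<in>pr ` A. {\<omega>\<in>\<Omega>. pr \<omega> = x})" by (auto simp: Bad_def)
  have "card Bad \<le> (\<Sum>x\<in>pr ` A. card {\<omega>\<in>\<Omega>. pr \<omega> = x})"
    unfolding Bad using finA by (intro card_UN_le) auto
  then have "real (card Bad) \<le> (\<Sum>x\<in>pr ` A. real (card {\<omega>\<in>\<Omega>. pr \<omega> = x}))"
    by (metis of_nat_le_iff of_nat_sum)
  also have "\<dots> \<le> (\<Sum>x\<in>pr ` A. M / m)"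
    using fibre m by (intro sum_mono) (simp add: field_simps)
  also have "\<dots> = t * (M / m)" using A by (simp add: card_image)
  also have "\<dots> \<le> k * (M / m)" using Suc.prems M m by (intro mult_right_mono) auto
  finally have bad: "real (card Bad) \<le> k * (M / m)" .
  have "sum \<phi> Bad \<le> card Bad * real (card V)"
    using sum_mono[of Bad \<phi> "\<lambda>_. real (card V)"] \<phi>_le by simp
  also have "\<dots> \<le> k * (M / m) * card V" using bad by (intro mult_right_mono) auto
  finally have "sum \<phi> Bad \<le> k * (M / m) * card V" .
  moreover have "sum \<phi> \<Omega> = sum \<phi> (\<Omega> - Bad) + sum \<phi> Bad"
    using fin by (intro sum.subset_diff) (auto simp: Bad_def)
  ultimately have "sum \<phi> (\<Omega> - Bad) \<ge> M * ?\<Phi> - k * (M / m) * card V"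
    using total kt by (simp add: C_def)
  moreover have "M * ?\<Phi> \<ge> M * ((\<Sum>v\<in>V. w v * F v ^ k) - real t * real k * card V / m)"
    using sumA M by (intro mult_left_mono) auto
  ultimately have "sum \<phi> (\<Omega> - Bad) \<ge> M * ((\<Sum>v\<in>V. w v * F v ^ k) - real t * real k * card V / m)
      - k * (M / m) * card V" by linarith
  also have "M * ((\<Sum>v\<in>V. w v * F v ^ k) - real t * real k * card V / m) - k * (M / m) * card V
      = ((\<Sum>v\<in>V. w v * F v ^ k) - real (Suc t) * real k * card V / m) * M"
    using m by (simp add: field_simps)
  finally have ge: "((\<Sum>v\<in>V. w v * F v ^ k) - real (Suc t) * real k * card V / m) * M
      \<le> sum \<phi> (\<Omega> - Bad)" .
  \<comment> \<open>The error grows with \<open>t\<close>, so \<open>big\<close>, which concerns the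
    error at \<open>k\<close>, keeps the remaining sum positive.\<close>
  have "real (Suc t) * (real k * card V / m) \<le> real k * (real k * card V / m)"
    using Suc.prems m by (intro mult_right_mono) auto
  then have pos: "(\<Sum>v\<in>V. w v * F v ^ k) - real (Suc t) * real k * card V / m > 0"
    using big by (simp add: mult.assoc)
  have "card (\<Omega> - Bad) \<le> card \<Omega>" using fin by (intro card_mono) auto
  then obtain \<omega> where \<omega>: "\<omega> \<in> \<Omega> - Bad"
      "\<phi> \<omega> \<ge> (\<Sum>v\<in>V. w v * F v ^ k) - real (Suc t) * real k * card V / m"
    using sum_pos_exists_ge[OF _ _ pos ge M(2)] fin M by force
  have notin: "pr \<omega> \<notin> pr ` A" using \<omega> by (auto simp: Bad_def)
  show ?case
  proof (intro exI[of _ "insert \<omega> A"] conjI)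
    show "insert \<omega> A \<subseteq> \<Omega>" using A \<omega> by auto
    show "card (insert \<omega> A) = Suc t" using A finA notin by (subst card_insert_disjoint) auto
    show "inj_on pr (insert \<omega> A)" using A notin by auto
    have "{v\<in>V. \<forall>\<omega>'\<in>insert \<omega> A. X \<omega>' v} = {v\<in>C. X \<omega> v}" by (auto simp: C_def)
    then show "(\<Sum>v\<in>{v\<in>V. \<forall>\<omega>'\<in>insert \<omega> A. X \<omega>' v}. w v * F v ^ (k - Suc t))
       \<ge> (\<Sum>v\<in>V. w v * F v ^ k) - real (Suc t) * real k * card V / m"
      using \<omega> by (simp add: \<phi>_def j_def)
  qed
qed

text \<open>One greedy choice yields both bounds if \<open>v\<close> has weight 1 or -1 according to
  whether \<open>F v\<close> reaches \<open>g / 4\<close>. A large weighted sum over the survivors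
  forces many survivors and, being nonnegative, forces at least half of them to have
  \<open>F v \<ge> g / 4\<close>.\<close>

lemma dependent_choice:
  fixes F :: "'v \<Rightarrow> real" and X :: "'w \<Rightarrow> 'v \<Rightarrow> bool" and M m g :: real
  assumes fin: "finite \<Omega>" "finite V" and M: "real (card \<Omega>) \<le> M" "M > 0"
    and F: "\<And>v. v \<in> V \<Longrightarrow> F v * M = card {\<omega>\<in>\<Omega>. X \<omega> v}"
    and fibre: "\<And>x. real (card {\<omega>\<in>\<Omega>. pr \<omega> = x}) * m \<le> M" and m: "m > 0"
    and g: "g > 0" and avg: "(\<Sum>v\<in>V. F v) \<ge> g * card V"
    and k: "k \<ge> 1" and km: "real k * real k \<le> g ^ k / 4 * m" and V: "V \<noteq> {}"
  shows "\<exists>A\<subseteq>\<Omega>. card A = k \<and> inj_on pr A \<and>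
     real (card {v\<in>V. \<forall>\<omega>\<in>A. X \<omega> v}) \<ge> g ^ k / 4 * card V \<and>
     (\<Sum>v\<in>{v\<in>V. \<forall>\<omega>\<in>A. X \<omega> v}. F v) \<ge> g / 8 * card {v\<in>V. \<forall>\<omega>\<in>A. X \<omega> v}"
proof -
  define w where "w v = (if F v \<ge> g / 4 then 1 else -1 :: real)" for v
  have F0: "F v \<ge> 0" if "v \<in> V" for v
  proof -
    have "0 \<le> F v * M" using F[OF that] by simp
    then show ?thesis using M by (simp add: zero_le_mult_iff)
  qed
  have cV: "real (card V) > 0" using V fin by (simp add: card_gt_0_iff)
  \<comment> \<open>A negative weight costs \<open>2 * F v ^ k\<close>, at most
    \<open>2 * (g / 4) ^ k\<close>; against the power mean \<open>g ^ k\<close> this is at most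
    half, since \<open>k \<ge> 1\<close>.\<close>
  have "(\<Sum>v\<in>V. F v ^ k - 2 * (g / 4) ^ k) \<le> (\<Sum>v\<in>V. w v * F v ^ k)"
  proof (rule sum_mono)
    fix v assume v: "v \<in> V"
    show "F v ^ k - 2 * (g / 4) ^ k \<le> w v * F v ^ k"
    proof (cases "F v \<ge> g / 4")
      case False
      then have "F v ^ k \<le> (g / 4) ^ k" using F0[OF v] by (intro power_mono) auto
      then show ?thesis using False by (simp add: w_def)
    qed (use g in \<open>simp add: w_def\<close>)
  qed
  moreover have "(\<Sum>v\<in>V. F v ^ k) \<ge> g ^ k * card V"
    by (rule sum_power_ge) (use fin g F0 avg in auto)
  ultimately have "(\<Sum>v\<in>V. w v * F v ^ k) \<ge> (g ^ k - 2 * (g / 4) ^ k) * card V"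
    by (simp add: sum_subtractf algebra_simps)
  moreover have "(g ^ k - 2 * (g / 4) ^ k) * card V \<ge> g ^ k / 2 * card V"
  proof (intro mult_right_mono)
    have "(4::real) ^ 1 \<le> 4 ^ k" using k by (intro power_increasing) auto
    then have "2 / 4 ^ k \<le> (1 / 2 :: real)" by (simp add: field_simps)
    then have "g ^ k * (2 / 4 ^ k) \<le> g ^ k * (1 / 2)" using g by (intro mult_left_mono) auto
    then show "g ^ k / 2 \<le> g ^ k - 2 * (g / 4) ^ k" by (simp add: power_divide)
  qed auto
  ultimately have wsum: "(\<Sum>v\<in>V. w v * F v ^ k) \<ge> g ^ k / 2 * card V" by linarith
  have "real k * real k * card V \<le> g ^ k / 4 * m * card V"
    using km by (intro mult_right_mono) auto
  then have err: "real k * real k * card V / m \<le> g ^ k / 4 * card V"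
    using m by (simp add: field_simps)
  have "g ^ k / 4 * card V < g ^ k / 2 * card V" using g cV by simp
  then have big: "(\<Sum>v\<in>V. w v * F v ^ k) > real k * real k * card V / m"
    using err wsum by linarith
  have w1: "\<bar>w v\<bar> \<le> 1" for v by (simp add: w_def)
  obtain A where A: "A \<subseteq> \<Omega>" "card A = k" "inj_on pr A"
    and sumA: "(\<Sum>v\<in>{v\<in>V. \<forall>\<omega>\<in>A. X \<omega> v}. w v * F v ^ (k - k))
       \<ge> (\<Sum>v\<in>V. w v * F v ^ k) - real k * real k * card V / m"
    using greedy_choice[OF fin M F w1 fibre m big order.refl] by auto
  define C where "C = {v\<in>V. \<forall>\<omega>\<in>A. X \<omega> v}"
  have C: "finite C" "C \<subseteq> V" using fin by (auto simp: C_def)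
  have wC: "(\<Sum>v\<in>C. w v) \<ge> g ^ k / 4 * card V"
    using sumA err wsum by (simp add: C_def)
  have "(\<Sum>v\<in>C. w v) \<le> (\<Sum>v\<in>C. 1)" by (intro sum_mono) (simp add: w_def)
  then have cardC: "real (card C) \<ge> g ^ k / 4 * card V" using wC by simp
  \<comment> \<open>\<open>g / 8 * (1 + w v)\<close> is \<open>g / 4\<close> on positive weights and
    0 on negative ones, hence a lower bound for \<open>F v\<close>.\<close>
  have "(\<Sum>v\<in>C. g / 8 * (1 + w v)) \<le> (\<Sum>v\<in>C. F v)"
    using C F0 by (intro sum_mono) (auto simp: w_def)
  then have "g / 8 * (card C + (\<Sum>v\<in>C. w v)) \<le> (\<Sum>v\<in>C. F v)"
    by (simp only: sum.distrib sum_distrib_left[symmetric]) simp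
  moreover have "(\<Sum>v\<in>C. w v) \<ge> 0" using wC g cV by (smt (verit) divide_nonneg_nonneg mult_nonneg_nonneg zero_le_power)
  then have "g / 8 * card C \<le> g / 8 * (card C + (\<Sum>v\<in>C. w v))"
    using g by (intro mult_left_mono) auto
  ultimately have "(\<Sum>v\<in>C. F v) \<ge> g / 8 * card C" by linarith
  then show ?thesis using A cardC unfolding C_def by blast
qed


section \<open>Partite homomorphisms split along an independent set\<close>

text \<open>The maps are extensional, so that the cardinality over the product of the part sizes is
  the partite homomorphism density.\<close>

definition homs :: "'a set \<Rightarrow> ('a \<Rightarrow> 'a \<Rightarrow> bool) \<Rightarrow> ('b \<Rightarrow> 'b \<Rightarrow> bool) \<Rightarrow> ('a \<Rightarrow> 'b set) \<Rightarrow> ('a \<Rightarrow> 'b) set"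
  where "homs S E R Y = {f \<in> PiE S Y. \<forall>u\<in>S. \<forall>v\<in>S. E u v \<longrightarrow> R (f u) (f v)}"

text \<open>The cross condition under which maps on \<open>J\<close> and on an independent set
  \<open>I\<close> glue to a homomorphism.\<close>

definition joined :: "'a set \<Rightarrow> 'a set \<Rightarrow> ('a \<Rightarrow> 'a \<Rightarrow> bool) \<Rightarrow> ('b \<Rightarrow> 'b \<Rightarrow> bool) \<Rightarrow> ('a \<Rightarrow> 'b) \<Rightarrow> ('a \<Rightarrow> 'b) \<Rightarrow> bool"
  where "joined J I E R \<omega> v \<longleftrightarrow> (\<forall>u\<in>J. \<forall>j\<in>I. E u j \<longrightarrow> R (\<omega> u) (v j))"

text \<open>The side at \<open>j\<close> of the box of \<open>\<omega>\<close>.\<close>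

definition common_nbrs :: "'a set \<Rightarrow> ('a \<Rightarrow> 'a \<Rightarrow> bool) \<Rightarrow> ('b \<Rightarrow> 'b \<Rightarrow> bool) \<Rightarrow> ('a \<Rightarrow> 'b set) \<Rightarrow> ('a \<Rightarrow> 'b) \<Rightarrow> 'a \<Rightarrow> 'b set"
  where "common_nbrs J E R Y \<omega> j = {y \<in> Y j. \<forall>u\<in>J. E u j \<longrightarrow> R (\<omega> u) y}"

lemma homs_cong:
  "(\<And>v. v \<in> S \<Longrightarrow> Y v = Y' v) \<Longrightarrow> homs S E R Y = homs S E R Y'"
  unfolding homs_def using PiE_cong[of S Y Y'] by auto

lemma homs_subset: "homs S E R Y \<subseteq> PiE S Y"
  by (auto simp: homs_def)

lemma finite_homs:
  "finite S \<Longrightarrow> (\<And>v. v \<in> S \<Longrightarrow> finite (Y v)) \<Longrightarrow> finite (homs S E R Y)"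
  by (rule finite_subset[OF homs_subset]) (rule finite_PiE)

lemma joined_box:
  "{v \<in> PiE I Y. joined J I E R \<omega> v} = PiE I (common_nbrs J E R Y \<omega>)"
  by (auto simp: joined_def common_nbrs_def PiE_iff extensional_def)

text \<open>With \<open>I\<close> independent, an edge inside \<open>I \<union> J\<close> lies in
  \<open>J\<close> or joins \<open>J\<close> to \<open>I\<close>. The first kind is recorded by
  \<open>\<omega>\<close>, the second by \<open>joined\<close>; gluing is the inverse map.\<close>

lemma bij_betw_homs_split:
  assumes disj: "I \<inter> J = {}" and indep: "\<And>u v. u \<in> I \<Longrightarrow> v \<in> I \<Longrightarrow> \<not> E u v"
    and E: "\<And>u v. E u v \<Longrightarrow> E v u" and R: "\<And>x y. R x y \<Longrightarrow> R y x"
  shows "bij_betw (\<lambda>f. (restrict f J, restrict f I)) (homs (I \<union> J) E R Y)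
           {(\<omega>, v). \<omega> \<in> homs J E R Y \<and> v \<in> PiE I Y \<and> joined J I E R \<omega> v}"
proof (rule bij_betw_byWitness[where f' = "\<lambda>(\<omega>, v) i. if i \<in> I then v i else \<omega> i"])
  show "\<forall>f\<in>homs (I \<union> J) E R Y.
      (\<lambda>(\<omega>, v) i. if i \<in> I then v i else \<omega> i) (restrict f J, restrict f I) = f"
    by (auto simp: homs_def fun_eq_iff PiE_iff extensional_def)
  show "\<forall>p\<in>{(\<omega>, v). \<omega> \<in> homs J E R Y \<and> v \<in> PiE I Y \<and> joined J I E R \<omega> v}.
      (\<lambda>f. (restrict f J, restrict f I)) ((\<lambda>(\<omega>, v) i. if i \<in> I then v i else \<omega> i) p) = p"
    using disj by (auto simp: homs_def fun_eq_iff PiE_iff extensional_def restrict_def)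
  show "(\<lambda>f. (restrict f J, restrict f I)) ` homs (I \<union> J) E R Y
      \<subseteq> {(\<omega>, v). \<omega> \<in> homs J E R Y \<and> v \<in> PiE I Y \<and> joined J I E R \<omega> v}"
    by (auto simp: homs_def joined_def PiE_iff)
  show "(\<lambda>(\<omega>, v) i. if i \<in> I then v i else \<omega> i) `
      {(\<omega>, v). \<omega> \<in> homs J E R Y \<and> v \<in> PiE I Y \<and> joined J I E R \<omega> v} \<subseteq> homs (I \<union> J) E R Y"
  proof clarify
    fix \<omega> v assume *: "\<omega> \<in> homs J E R Y" "v \<in> PiE I Y" "joined J I E R \<omega> v"
    define f where "f i = (if i \<in> I then v i else \<omega> i)" for i
    have "f \<in> PiE (I \<union> J) Y" using * by (auto simp: homs_def PiE_iff extensional_def f_def)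
    moreover have "R (f x) (f y)" if "x \<in> I \<union> J" "y \<in> I \<union> J" "E x y" for x y
      using that * indep disj R E unfolding homs_def joined_def f_def by (auto split: if_splits)
    ultimately show "(\<lambda>i. if i \<in> I then v i else \<omega> i) \<in> homs (I \<union> J) E R Y"
      by (simp add: homs_def f_def[symmetric])
  qed
qed

text \<open>The same glued pairs counted twice: grouped by \<open>\<omega>\<close> they give box
  sizes, grouped by \<open>v\<close> the number of \<open>\<omega>\<close> joined to
  \<open>v\<close>.\<close>

lemma card_homs_split:
  assumes fin: "finite I" "finite J" "\<And>v. v \<in> I \<union> J \<Longrightarrow> finite (Y v)"
    and *: "I \<inter> J = {}" "\<And>u v. u \<in> I \<Longrightarrow> v \<in> I \<Longrightarrow> \<not> E u v"
    "\<And>u v. E u v \<Longrightarrow> E v u" "\<And>x y. R x y \<Longrightarrow> R y x"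
  shows "card (homs (I \<union> J) E R Y) = (\<Sum>\<omega>\<in>homs J E R Y. \<Prod>j\<in>I. card (common_nbrs J E R Y \<omega> j))"
    and "card (homs (I \<union> J) E R Y) = (\<Sum>v\<in>PiE I Y. card {\<omega> \<in> homs J E R Y. joined J I E R \<omega> v})"
proof -
  have finH: "finite (homs J E R Y)" and finP: "finite (PiE I Y)"
    using fin by (auto intro!: finite_homs finite_PiE)
  have eq: "card (homs (I \<union> J) E R Y)
      = card {(\<omega>, v). \<omega> \<in> homs J E R Y \<and> v \<in> PiE I Y \<and> joined J I E R \<omega> v}"
    by (rule bij_betw_same_card[OF bij_betw_homs_split[OF *]])
  also have "{(\<omega>, v). \<omega> \<in> homs J E R Y \<and> v \<in> PiE I Y \<and> joined J I E R \<omega> v}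
      = Sigma (homs J E R Y) (\<lambda>\<omega>. PiE I (common_nbrs J E R Y \<omega>))"
    unfolding joined_box[symmetric] by auto
  also have "card \<dots> = (\<Sum>\<omega>\<in>homs J E R Y. card (PiE I (common_nbrs J E R Y \<omega>)))"
    using finH finP by (intro card_SigmaI ballI) (auto simp: joined_box[symmetric])
  also have "\<dots> = (\<Sum>\<omega>\<in>homs J E R Y. \<Prod>j\<in>I. card (common_nbrs J E R Y \<omega> j))"
    using fin by (simp add: card_PiE)
  finally show "card (homs (I \<union> J) E R Y) = (\<Sum>\<omega>\<in>homs J E R Y. \<Prod>j\<in>I. card (common_nbrs J E R Y \<omega> j))" .
  have "card (homs (I \<union> J) E R Y)
      = card (prod.swap ` {(\<omega>, v). \<omega> \<in> homs J E R Y \<and> v \<in> PiE I Y \<and> joined J I E R \<omega> v})"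
    unfolding eq by (simp add: card_image)
  also have "prod.swap ` {(\<omega>, v). \<omega> \<in> homs J E R Y \<and> v \<in> PiE I Y \<and> joined J I E R \<omega> v}
      = Sigma (PiE I Y) (\<lambda>v. {\<omega> \<in> homs J E R Y. joined J I E R \<omega> v})"
    by auto
  also have "card \<dots> = (\<Sum>v\<in>PiE I Y. card {\<omega> \<in> homs J E R Y. joined J I E R \<omega> v})"
    using finH finP by (intro card_SigmaI ballI) auto
  finally show "card (homs (I \<union> J) E R Y)
      = (\<Sum>v\<in>PiE I Y. card {\<omega> \<in> homs J E R Y. joined J I E R \<omega> v})" .
qed

text \<open>A map is determined by its image of \<open>a\<close> and its other coordinates. This
  bounds the loss caused by asking for distinct images of \<open>a\<close>.\<close>

lemma card_fibre_le:
  assumes fin: "finite J" "\<And>v. v \<in> J \<Longrightarrow> finite (Y v)" and a: "a \<in> J"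
  shows "card {\<omega> \<in> PiE J Y. \<omega> a = x} \<le> (\<Prod>v\<in>J - {a}. card (Y v))"
proof -
  have "inj_on (\<lambda>\<omega>. restrict \<omega> (J - {a})) {\<omega> \<in> PiE J Y. \<omega> a = x}"
  proof (rule inj_onI)
    fix f h assume f: "f \<in> {\<omega> \<in> PiE J Y. \<omega> a = x}" and h: "h \<in> {\<omega> \<in> PiE J Y. \<omega> a = x}"
      and eq: "restrict f (J - {a}) = restrict h (J - {a})"
    show "f = h"
    proof
      fix i show "f i = h i"
        using f h fun_cong[OF eq, of i] by (cases "i \<in> J") (auto simp: PiE_iff extensional_def restrict_def split: if_splits)
    qed
  qed
  then have "card {\<omega> \<in> PiE J Y. \<omega> a = x} \<le> card (PiE (J - {a}) Y)"
    using fin by (intro card_inj_on_le) (auto intro!: finite_PiE simp: restrict_def split: if_splits)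
  then show ?thesis using fin by (simp add: card_PiE)
qed

text \<open>Deleting \<open>a\<close> only drops conditions, and a map is recovered from its
  restriction and its value at \<open>a\<close>. Hence the density of \<open>\<omega>\<close> joined
  to \<open>v\<close> does not decrease when \<open>a\<close> is removed.\<close>

lemma card_joined_le:
  assumes fin: "finite J" "\<And>v. v \<in> J \<Longrightarrow> finite (Y v)" and a: "a \<in> J"
  shows "card {\<omega> \<in> homs J E R Y. joined J I E R \<omega> v}
    \<le> card (Y a) * card {\<omega> \<in> homs (J - {a}) E R Y. joined (J - {a}) I E R \<omega> v}"
proof -
  let ?T = "{\<omega> \<in> homs (J - {a}) E R Y. joined (J - {a}) I E R \<omega> v}"
  have "inj_on (\<lambda>\<omega>. (\<omega> a, restrict \<omega> (J - {a}))) {\<omega> \<in> homs J E R Y. joined J I E R \<omega> v}"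
  proof (rule inj_onI)
    fix f h assume f: "f \<in> {\<omega> \<in> homs J E R Y. joined J I E R \<omega> v}"
      and h: "h \<in> {\<omega> \<in> homs J E R Y. joined J I E R \<omega> v}"
      and "(f a, restrict f (J - {a})) = (h a, restrict h (J - {a}))"
    then have eq: "f a = h a" "restrict f (J - {a}) = restrict h (J - {a})" by auto
    show "f = h"
    proof
      fix i show "f i = h i"
        using f h eq(1) fun_cong[OF eq(2), of i]
        by (cases "i \<in> J") (auto simp: homs_def PiE_iff extensional_def restrict_def split: if_splits)
    qed
  qed
  moreover have "(\<lambda>\<omega>. (\<omega> a, restrict \<omega> (J - {a}))) ` {\<omega> \<in> homs J E R Y. joined J I E R \<omega> v} \<subseteq> Y a \<times> ?T"
    using a by (auto simp: homs_def joined_def PiE_iff extensional_def split: if_split_asm)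
  moreover have "finite (homs (J - {a}) E R Y)" using fin by (intro finite_homs) auto
  then have "finite (Y a \<times> ?T)" using fin a by auto
  ultimately have "card {\<omega> \<in> homs J E R Y. joined J I E R \<omega> v} \<le> card (Y a \<times> ?T)"
    by (rule card_inj_on_le)
  then show ?thesis by (simp add: card_cartesian_product)
qed

text \<open>All ratios \<open>x i / y i\<close> are at most 1, so none is smaller than their
  product. This transfers a lower bound on the size of a box to each of its sides.\<close>

lemma prod_ratio_factor:
  fixes x y :: "'a \<Rightarrow> real"
  assumes fin: "finite I" and xy: "\<And>i. i \<in> I \<Longrightarrow> 0 \<le> x i \<and> x i \<le> y i" and y: "\<And>i. i \<in> I \<Longrightarrow> 0 < y i"
    and le: "c * (\<Prod>i\<in>I. y i) \<le> (\<Prod>i\<in>I. x i)" and j: "j \<in> I"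
  shows "c * y j \<le> x j"
proof -
  have p: "(\<Prod>i\<in>I - {j}. y i) > 0" using y by (intro prod_pos) auto
  have "c * y j * (\<Prod>i\<in>I - {j}. y i) = c * (\<Prod>i\<in>I. y i)"
    using fin j by (simp add: prod.remove)
  also have "\<dots> \<le> (\<Prod>i\<in>I. x i)" by (rule le)
  also have "\<dots> = x j * (\<Prod>i\<in>I - {j}. x i)" using fin j by (simp add: prod.remove)
  also have "\<dots> \<le> x j * (\<Prod>i\<in>I - {j}. y i)"
    using xy j by (intro mult_left_mono prod_mono) auto
  finally show ?thesis using p by simp
qed


section \<open>Homomorphism density forces a blowup\<close>

text \<open>A recursion step replaces \<open>n\<close> by \<open>n - 1\<close> and \<open>g\<close>
  by \<open>g / 8\<close> and shrinks parts by \<open>g ^ k / 4\<close>. The first bound feeds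
  \<open>dependent_choice\<close>, the second preserves the size hypothesis: the new base is half
  the old one, and the exponent falls by \<open>2 * k\<close>, which leaves a factor
  \<open>(16 ^ n / g) ^ (2 * k)\<close> to pay for the shrinkage.\<close>

lemma blowup_size_arith:
  fixes g :: real
  assumes n: "n \<ge> 1" and g: "0 < g" "g \<le> 1" and k: "k \<ge> 1"
  shows "real k * real k \<le> g ^ k / 4 * (16 ^ n / g) ^ (2 * (n + 1) * k)" (is ?A)
    and "(16 ^ (n - 1) / (g / 8)) ^ (2 * n * k) \<le> g ^ k / 4 * (16 ^ n / g) ^ (2 * (n + 1) * k)" (is ?B)
proof -
  define b where "b = 16 ^ n / g"
  have "(16::real) ^ 1 \<le> 16 ^ n" using n by (intro power_increasing) auto
  then have bg: "b * g \<ge> 16" using g by (simp add: b_def)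
  have "b * g \<le> b" using g by (simp add: b_def field_simps)
  then have b: "b \<ge> 16" using bg by linarith
  \<comment> \<open>Here \<open>256 = 4 * 64\<close>: the factor \<open>64 ^ k\<close> absorbs the
    constant 4, and \<open>4 ^ k\<close> dominates \<open>k * k\<close>.\<close>
  have "(16 * 16) ^ k \<le> (b * (b * g)) ^ k"
    using b bg by (intro power_mono mult_mono) auto
  also have "(b * (b * g)) ^ k = g ^ k * b ^ (2 * k)"
    by (simp add: power_mult_distrib power_mult power2_eq_square mult_ac)
  finally have big: "4 ^ k * 64 ^ k \<le> g ^ k * b ^ (2 * k)"
    by (simp flip: power_mult_distrib)
  have k64: "(64::real) ^ 1 \<le> 64 ^ k" using k by (intro power_increasing) auto
  have "(4::real) ^ k * 4 \<le> 4 ^ k * 64 ^ k" using k64 by (intro mult_left_mono) auto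
  then have "4 ^ k * 4 \<le> g ^ k * b ^ (2 * k)" using big by (rule order_trans)
  then have four: "4 ^ k \<le> g ^ k / 4 * b ^ (2 * k)" by simp
  have D: "b ^ (2 * (n + 1) * k) = b ^ (2 * k) * b ^ (2 * n * k)"
    by (simp add: power_add[symmetric] algebra_simps)
  have b1: "b ^ (2 * n * k) \<ge> 1" using b by (intro one_le_power) auto
  have "real k \<le> 2 ^ k" by (metis less_exp less_imp_le numeral_power_le_of_nat_cancel_iff of_nat_le_iff of_nat_numeral of_nat_power)
  then have "real k * real k \<le> 2 ^ k * 2 ^ k" by (intro mult_mono) auto
  also have "\<dots> = 4 ^ k" by (simp flip: power_mult_distrib)
  also have "\<dots> \<le> g ^ k / 4 * b ^ (2 * k) * 1" using four by simp
  also have "\<dots> \<le> g ^ k / 4 * b ^ (2 * k) * b ^ (2 * n * k)"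
    using b1 b g by (intro mult_left_mono) auto
  finally show ?A unfolding b_def[symmetric] D by (simp add: mult_ac)
  have "(16::real) ^ n = 16 * 16 ^ (n - 1)" using n by (cases n) auto
  then have "16 ^ (n - 1) / (g / 8) \<le> b" using g by (simp add: b_def field_simps)
  then have "(16 ^ (n - 1) / (g / 8)) ^ (2 * n * k) \<le> 1 * b ^ (2 * n * k)"
    using g by (simp add: power_mono)
  also have "\<dots> \<le> g ^ k / 4 * b ^ (2 * k) * b ^ (2 * n * k)"
  proof (intro mult_right_mono)
    have "(1::real) \<le> 4 ^ k" by simp
    then show "1 \<le> g ^ k / 4 * b ^ (2 * k)" using four by linarith
  qed (use b in auto)
  finally show ?B unfolding b_def[symmetric] D by (simp add: mult_ac)
qed

text \<open>Induction on the number of vertices with \<open>g\<close> and \<open>Y\<close> general,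
  because each step lowers the density and shrinks the parts at the neighbours of the removed
  vertex.\<close>

lemma blowup_from_hom_density:
  fixes E :: "'a \<Rightarrow> 'a \<Rightarrow> bool" and R :: "'b \<Rightarrow> 'b \<Rightarrow> bool"
  assumes symE: "\<And>u v. E u v \<Longrightarrow> E v u" and irr: "\<And>v. \<not> E v v"
    and tf: "\<And>x y z. E x y \<Longrightarrow> E y z \<Longrightarrow> \<not> E x z"
    and symR: "\<And>x y. R x y \<Longrightarrow> R y x" and k: "k \<ge> 1"
  shows "finite S \<Longrightarrow> card S = n \<Longrightarrow> 0 < g \<Longrightarrow> g \<le> 1 \<Longrightarrow>
    (\<And>v. v \<in> S \<Longrightarrow> finite (Y v) \<and> real (card (Y v)) \<ge> (16 ^ n / g) ^ (2 * (n + 1) * k)) \<Longrightarrow>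
    real (card (homs S E R Y)) \<ge> g * (\<Prod>v\<in>S. real (card (Y v))) \<Longrightarrow>
    \<exists>A. (\<forall>v\<in>S. A v \<subseteq> Y v \<and> card (A v) = k) \<and>
      (\<forall>u\<in>S. \<forall>v\<in>S. E u v \<longrightarrow> (\<forall>x\<in>A u. \<forall>y\<in>A v. R x y))"
proof (induction n arbitrary: S g Y)
  case 0
  then show ?case by auto
next
  case (Suc n)
  note finS = \<open>finite S\<close> and g = \<open>0 < g\<close> \<open>g \<le> 1\<close>
  obtain a where a: "a \<in> S" using Suc.prems(2) by (metis card.empty nat.distinct(1) equals0I)
  define I where "I = {j\<in>S. E a j}"
  define J where "J = S - I"
  define b where "b = (16 ^ Suc n / g) ^ (2 * (Suc n + 1) * k)"
  have b0: "b > 0" using g by (simp add: b_def)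
  have S: "I \<union> J = S" "I \<inter> J = {}" "I \<subseteq> S" "J \<subseteq> S" by (auto simp: I_def J_def)
  have aJ: "a \<in> J" "a \<notin> I" using a irr by (auto simp: I_def J_def)
  have finIJ: "finite I" "finite J" using finS S finite_subset by blast+
  have finY: "finite (Y v)" if "v \<in> S" for v using Suc.prems that by blast
  have Yb: "real (card (Y v)) \<ge> b" if "v \<in> S" for v using Suc.prems(5)[OF that] by (simp add: b_def)
  have Y0: "real (card (Y v)) > 0" if "v \<in> S" for v using Yb[OF that] b0 by linarith
  have indep: "\<And>u v. u \<in> I \<Longrightarrow> v \<in> I \<Longrightarrow> \<not> E u v"
    using tf by (auto simp: I_def)
  define \<Omega> where "\<Omega> = homs J E R Y"
  define V where "V = PiE I Y"
  define M where "M = (\<Prod>v\<in>J. real (card (Y v)))"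
  define F where "F v = real (card {\<omega>\<in>\<Omega>. joined J I E R \<omega> v}) / M" for v
  have M0: "M > 0" unfolding M_def using Y0 S by (intro prod_pos) auto
  have fin\<Omega>: "finite \<Omega>" unfolding \<Omega>_def using finIJ S finY by (intro finite_homs) auto
  have finV: "finite V" unfolding V_def using finIJ S finY by (intro finite_PiE) auto
  have cV: "real (card V) = (\<Prod>v\<in>I. real (card (Y v)))"
    unfolding V_def using finIJ by (simp add: card_PiE)
  have cardM: "real (card (PiE J Y)) = M" unfolding M_def using finIJ by (simp add: card_PiE)
  have finPJ: "finite (PiE J Y)" using finIJ S finY by (intro finite_PiE) auto
  have "card \<Omega> \<le> card (PiE J Y)"
    unfolding \<Omega>_def using finPJ homs_subset by (intro card_mono)
  then have \<Omega>M: "real (card \<Omega>) \<le> M" using cardM by linarith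
  have MJ: "M = card (Y a) * (\<Prod>v\<in>J - {a}. real (card (Y v)))"
    unfolding M_def using finIJ aJ by (simp add: prod.remove)
  have fibre: "real (card {\<omega>\<in>\<Omega>. \<omega> a = x}) * real (card (Y a)) \<le> M" for x
  proof -
    have "card {\<omega>\<in>\<Omega>. \<omega> a = x} \<le> card {\<omega>\<in>PiE J Y. \<omega> a = x}"
      using finPJ unfolding \<Omega>_def by (intro card_mono) (auto simp: homs_def)
    also have "\<dots> \<le> (\<Prod>v\<in>J - {a}. card (Y v))"
      by (rule card_fibre_le) (use finIJ aJ S(4) finY in auto)
    finally have "real (card {\<omega>\<in>\<Omega>. \<omega> a = x}) \<le> (\<Prod>v\<in>J - {a}. real (card (Y v)))"
      by (simp only: of_nat_prod[symmetric] of_nat_le_iff)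
    then have "real (card (Y a)) * real (card {\<omega>\<in>\<Omega>. \<omega> a = x}) \<le> M"
      unfolding MJ by (intro mult_left_mono) auto
    then show ?thesis by (simp add: mult.commute)
  qed
  have prodS: "(\<Prod>v\<in>S. real (card (Y v))) = card V * M"
    unfolding cV M_def S(1)[symmetric] by (rule prod.union_disjoint) (use finIJ S in auto)
  have "card (homs S E R Y) = (\<Sum>v\<in>V. card {\<omega> \<in> \<Omega>. joined J I E R \<omega> v})"
    unfolding V_def \<Omega>_def S(1)[symmetric]
    by (rule card_homs_split(2)) (use finIJ finY S indep symE symR in auto)
  then have "real (card (homs S E R Y)) = (\<Sum>v\<in>V. F v) * M"
    using M0 by (simp add: F_def sum_divide_distrib[symmetric])
  then have "(g * card V) * M \<le> (\<Sum>v\<in>V. F v) * M"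
    using Suc.prems(6) unfolding prodS by (simp add: mult_ac)
  then have avg: "(\<Sum>v\<in>V. F v) \<ge> g * card V" using M0 mult_le_cancel_right_pos by blast
  have arith: "real k * real k \<le> g ^ k / 4 * b"
    "(16 ^ n / (g / 8)) ^ (2 * Suc n * k) \<le> g ^ k / 4 * b"
    using blowup_size_arith[of "Suc n" g k] g k by (simp_all add: b_def)
  have "g ^ k / 4 * b \<le> g ^ k / 4 * real (card (Y a))"
    using Yb[OF a] g by (intro mult_left_mono) auto
  then have km: "real k * real k \<le> g ^ k / 4 * real (card (Y a))" using arith by linarith
  have "real (card V) > 0" unfolding cV using Y0 S by (intro prod_pos) auto
  then have Vne: "V \<noteq> {}" by auto
  \<comment> \<open>The chosen \<open>\<omega>\<close> are tested against all partite maps on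
    \<open>I\<close>. The projection kept injective is \<open>\<omega> a\<close>, with fibres of
    size at most \<open>M / card (Y a)\<close>.\<close>
  obtain A0 where A0: "A0 \<subseteq> \<Omega>" "card A0 = k" "inj_on (\<lambda>\<omega>. \<omega> a) A0"
    and C1: "real (card {v\<in>V. \<forall>\<omega>\<in>A0. joined J I E R \<omega> v}) \<ge> g ^ k / 4 * card V"
    and C2: "(\<Sum>v\<in>{v\<in>V. \<forall>\<omega>\<in>A0. joined J I E R \<omega> v}. F v)
        \<ge> g / 8 * card {v\<in>V. \<forall>\<omega>\<in>A0. joined J I E R \<omega> v}"
    using dependent_choice[OF fin\<Omega> finV \<Omega>M M0 _ fibre Y0[OF a] g(1) avg k km Vne, of "joined J I E R"] M0
    by (auto simp: F_def)
  \<comment> \<open>An intersection of boxes is a box: \<open>B j\<close> collects the common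
    neighbours for all \<open>\<omega>\<close> in \<open>A0\<close> at once.\<close>
  define B where "B j = {y\<in>Y j. \<forall>\<omega>\<in>A0. \<forall>u\<in>J. E u j \<longrightarrow> R (\<omega> u) y}" for j
  define C where "C = PiE I B"
  have Ceq: "{v\<in>V. \<forall>\<omega>\<in>A0. joined J I E R \<omega> v} = C"
    by (auto simp: C_def V_def B_def joined_def PiE_iff extensional_def)
  note C1 = C1[unfolded Ceq] and C2 = C2[unfolded Ceq]
  have cC: "real (card C) = (\<Prod>v\<in>I. real (card (B v)))"
    unfolding C_def using finIJ by (simp add: card_PiE)
  have finB: "finite (B v)" if "v \<in> S" for v using finY[OF that] by (auto simp: B_def)
  have Bge: "g ^ k / 4 * card (Y j) \<le> card (B j)" if j: "j \<in> I" for j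
  proof (rule prod_ratio_factor[where x = "\<lambda>j. real (card (B j))" and y = "\<lambda>j. real (card (Y j))", OF finIJ(1) _ _ _ j])
    fix i assume "i \<in> I"
    then have i: "i \<in> S" using S by auto
    have "card (B i) \<le> card (Y i)" using finY[OF i] by (intro card_mono) (auto simp: B_def)
    then show "0 \<le> real (card (B i)) \<and> real (card (B i)) \<le> real (card (Y i))" by simp
    show "0 < real (card (Y i))" using Y0[OF i] .
  next
    show "g ^ k / 4 * (\<Prod>i\<in>I. real (card (Y i))) \<le> (\<Prod>i\<in>I. real (card (B i)))"
      using C1 by (simp add: cV cC)
  qed
  define Y' where "Y' v = (if v \<in> I then B v else Y v)" for v
  let ?S = "S - {a}"
  let ?J = "J - {a}"
  have S': "I \<union> ?J = ?S" using S aJ by auto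
  have sub: "Y' v \<subseteq> Y v" for v by (auto simp: Y'_def B_def)
  have finY': "finite (Y' v)" if "v \<in> S" for v using finY[OF that] sub finite_subset by blast
  have gk1: "g ^ k / 4 \<le> 1" using power_le_one[of g k] g by simp
  have Y'ge: "real (card (Y' v)) \<ge> (16 ^ n / (g / 8)) ^ (2 * (n + 1) * k)" if v: "v \<in> S" for v
  proof -
    have "g ^ k / 4 * card (Y v) \<le> card (Y' v)"
    proof (cases "v \<in> I")
      case False
      have "g ^ k / 4 * card (Y v) \<le> 1 * real (card (Y v))" using gk1 by (intro mult_right_mono) auto
      then show ?thesis using False by (simp add: Y'_def)
    qed (use Bge in \<open>simp add: Y'_def\<close>)
    moreover have "g ^ k / 4 * b \<le> g ^ k / 4 * card (Y v)"
      using Yb[OF v] g by (intro mult_left_mono) auto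
    ultimately show ?thesis using arith(2) by simp
  qed
  have eqJ: "homs ?J E R Y' = homs ?J E R Y"
    by (rule homs_cong) (auto simp: Y'_def J_def)
  have eqI: "PiE I Y' = C"
    unfolding C_def by (rule PiE_cong) (simp add: Y'_def)
  have "card (homs ?S E R Y') = (\<Sum>v\<in>C. card {\<omega> \<in> homs ?J E R Y. joined ?J I E R \<omega> v})"
    unfolding eqI[symmetric] eqJ[symmetric] S'[symmetric]
    by (rule card_homs_split(2)) (use finIJ finY' S indep symE symR in auto)
  then have homs': "real (card (homs ?S E R Y'))
      = (\<Sum>v\<in>C. real (card {\<omega> \<in> homs ?J E R Y. joined ?J I E R \<omega> v}))" by simp
  define M' where "M' = (\<Prod>v\<in>?J. real (card (Y v)))"
  have M': "M = card (Y a) * M'" using MJ by (simp add: M'_def)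
  have F_le: "F v * M' \<le> real (card {\<omega> \<in> homs ?J E R Y. joined ?J I E R \<omega> v})" for v
  proof -
    have "card {\<omega> \<in> homs J E R Y. joined J I E R \<omega> v}
        \<le> card (Y a) * card {\<omega> \<in> homs ?J E R Y. joined ?J I E R \<omega> v}"
      by (rule card_joined_le) (use finIJ aJ S(4) finY in auto)
    then have "real (card {\<omega> \<in> \<Omega>. joined J I E R \<omega> v})
        \<le> real (card (Y a)) * real (card {\<omega> \<in> homs ?J E R Y. joined ?J I E R \<omega> v})"
      unfolding \<Omega>_def by (simp only: of_nat_mult[symmetric] of_nat_le_iff)
    moreover have "real (card {\<omega> \<in> \<Omega>. joined J I E R \<omega> v}) = F v * M"
      using M0 by (simp add: F_def)
    then have "real (card {\<omega> \<in> \<Omega>. joined J I E R \<omega> v}) = real (card (Y a)) * (F v * M')"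
      by (simp only: M' mult_ac)
    ultimately show ?thesis using Y0[OF a] by simp
  qed
  have M'0: "M' > 0" unfolding M'_def using Y0 S by (intro prod_pos) auto
  have "(\<Prod>v\<in>?S. real (card (Y' v))) = (\<Prod>v\<in>I. real (card (Y' v))) * (\<Prod>v\<in>?J. real (card (Y' v)))"
    unfolding S'[symmetric] by (rule prod.union_disjoint) (use finIJ S in auto)
  also have "(\<Prod>v\<in>I. real (card (Y' v))) = card C" by (simp add: cC Y'_def)
  also have "(\<Prod>v\<in>?J. real (card (Y' v))) = M'"
    unfolding M'_def by (rule prod.cong) (auto simp: Y'_def J_def)
  finally have prodS': "(\<Prod>v\<in>?S. real (card (Y' v))) = card C * M'" .
  have "g / 8 * (card C * M') = (g / 8 * card C) * M'" by simp
  also have "\<dots> \<le> (\<Sum>v\<in>C. F v) * M'" using C2 M'0 by (intro mult_right_mono) auto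
  also have "\<dots> \<le> real (card (homs ?S E R Y'))"
    unfolding homs' sum_distrib_right by (intro sum_mono F_le)
  finally have dens: "g / 8 * (\<Prod>v\<in>?S. real (card (Y' v))) \<le> real (card (homs ?S E R Y'))"
    unfolding prodS' .
  have "finite ?S" "card ?S = n" "0 < g / 8" "g / 8 \<le> 1" using finS Suc.prems(2) a g by auto
  then have "\<exists>A. (\<forall>v\<in>?S. A v \<subseteq> Y' v \<and> card (A v) = k) \<and>
      (\<forall>u\<in>?S. \<forall>v\<in>?S. E u v \<longrightarrow> (\<forall>x\<in>A u. \<forall>y\<in>A v. R x y))"
    by (rule Suc.IH) (use finY' Y'ge dens in auto)
  then obtain A where A: "\<And>v. v \<in> ?S \<Longrightarrow> A v \<subseteq> Y' v \<and> card (A v) = k"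
    and AR: "\<And>u v x y. u \<in> ?S \<Longrightarrow> v \<in> ?S \<Longrightarrow> E u v \<Longrightarrow> x \<in> A u \<Longrightarrow> y \<in> A v \<Longrightarrow> R x y"
    by (elim exE conjE) blast
  \<comment> \<open>The part for \<open>a\<close> consists of the \<open>k\<close> distinct images
    of \<open>a\<close> under the chosen homomorphisms.\<close>
  define A' where "A' = A(a := (\<lambda>\<omega>. \<omega> a) ` A0)"
  have A'a: "A' a = (\<lambda>\<omega>. \<omega> a) ` A0" by (simp add: A'_def)
  have A'v: "A' v = A v" if "v \<noteq> a" for v using that by (simp add: A'_def)
  \<comment> \<open>A neighbour of \<open>a\<close> has its part inside \<open>B\<close>, hence
    inside the neighbourhood of every \<open>\<omega> a\<close> with
    \<open>\<omega> \<in> A0\<close>.\<close>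
  have aR: "R x y" if *: "v \<in> S" "E a v" "x \<in> A' a" "y \<in> A' v" for v x y
  proof -
    have v: "v \<in> I" "v \<noteq> a" using that irr by (auto simp: I_def)
    then have "y \<in> B v" using A[of v] that A'v[of v] by (auto simp: Y'_def)
    moreover obtain \<omega> where "\<omega> \<in> A0" "x = \<omega> a" using * A'a by auto
    ultimately show "R x y" using aJ that by (auto simp: B_def)
  qed
  show ?case
  proof (intro exI[of _ A'] conjI ballI impI)
    fix v assume v: "v \<in> S"
    show "A' v \<subseteq> Y v"
    proof (cases "v = a")
      case True
      have "\<omega> a \<in> Y a" if "\<omega> \<in> A0" for \<omega>
        using that A0(1) aJ(1) by (auto simp: \<Omega>_def homs_def PiE_iff)
      then show ?thesis using True A'a by auto
    next
      case False
      then show ?thesis using A[of v] A'v[of v] sub[of v] v by auto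
    qed
    show "card (A' v) = k"
      using A[of v] A'v[of v] A'a v card_image[OF A0(3)] A0(2) by (cases "v = a") auto
  next
    fix u v x y assume *: "u \<in> S" "v \<in> S" "E u v" "x \<in> A' u" "y \<in> A' v"
    show "R x y"
    proof (cases "u = a")
      case True
      then show ?thesis using aR[of v x y] * by auto
    next
      case u: False
      show ?thesis
      proof (cases "v = a")
        case True
        then show ?thesis using aR[of u y x] * symE symR by auto
      next
        case False
        then show ?thesis using AR[of u v x y] * u A'v by auto
      qed
    qed
  qed
qed


section \<open>Density increment from a sparse box\<close>

lemma sum_degrees_swap:
  assumes "finite A" "finite B"
  shows "(\<Sum>x\<in>A. card {y\<in>B. R x y}) = (\<Sum>y\<in>B. card {x\<in>A. R x y})"
proof -
  have "(\<Sum>x\<in>A. card {y\<in>B. R x y}) = (\<Sum>x\<in>A. \<Sum>y\<in>B. if R x y then 1 else 0)"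
    using assms by (intro sum.cong refl) (simp add: sum.inter_filter[symmetric])
  also have "\<dots> = (\<Sum>y\<in>B. \<Sum>x\<in>A. if R x y then 1 else 0)" by (rule sum.swap)
  also have "\<dots> = (\<Sum>y\<in>B. card {x\<in>A. R x y})"
    using assms by (intro sum.cong refl) (simp add: sum.inter_filter[symmetric])
  finally show ?thesis .
qed

text \<open>Elements below the threshold account for at most \<open>\<rho> * card B\<close> each, so
  the surplus \<open>\<eta>\<close> is carried by elements of high degree, each adding at most
  \<open>card B\<close> more.\<close>

lemma card_high_degree_ge:
  fixes \<rho> \<eta> :: real
  assumes fin: "finite A" "finite B" and B: "B \<noteq> {}" and \<rho>: "\<rho> \<ge> 0"
    and e: "(\<rho> + \<eta>) * card B * card A \<le> (\<Sum>x\<in>A. real (card {y\<in>B. R x y}))"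
  shows "\<eta> * card A \<le> card {x\<in>A. real (card {y\<in>B. R x y}) \<ge> \<rho> * card B}"
proof -
  define H where "H = {x\<in>A. real (card {y\<in>B. R x y}) \<ge> \<rho> * card B}"
  have cB: "real (card B) > 0" using B fin by (simp add: card_gt_0_iff)
  have H: "H \<subseteq> A" by (auto simp: H_def)
  have "(\<Sum>x\<in>A. real (card {y\<in>B. R x y})) \<le> (\<Sum>x\<in>A. (if x \<in> H then real (card B) else 0) + \<rho> * card B)"
  proof (rule sum_mono)
    fix x assume "x \<in> A"
    have "card {y\<in>B. R x y} \<le> card B" using fin by (intro card_mono) auto
    then have "real (card {y\<in>B. R x y}) \<le> real (card B) + \<rho> * card B" using \<rho> by (simp add: add_increasing2)
    then show "real (card {y\<in>B. R x y}) \<le> (if x \<in> H then real (card B) else 0) + \<rho> * card B"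
      using \<open>x \<in> A\<close> by (auto simp: H_def)
  qed
  also have "\<dots> = (\<Sum>x\<in>A. if x \<in> H then real (card B) else 0) + card A * (\<rho> * card B)"
    by (simp add: sum.distrib)
  also have "(\<Sum>x\<in>A. if x \<in> H then real (card B) else 0) = card H * real (card B)"
    using fin H by (simp add: sum.If_cases Int_absorb1 Int_commute Int_def[symmetric] inf.absorb2)
  finally have "(\<eta> * card A) * card B \<le> card H * real (card B)"
    using e by (simp add: algebra_simps)
  then show ?thesis using cB unfolding H_def by simp
qed

text \<open>If, for every \<open>j\<close>, only few vertices of \<open>Z\<close> had relative
  degree below \<open>r / 2\<close> to \<open>D j\<close>, the box would be dense. So a share
  \<open>1 / (2 * m)\<close> of \<open>Z\<close> has low degree to one \<open>D j\<close>; deleting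
  it raises the average relative degree of \<open>D j\<close> into what remains of
  \<open>Z\<close>.\<close>

lemma density_increment:
  fixes r :: real and R :: "'b \<Rightarrow> 'b \<Rightarrow> bool"
  assumes fin: "finite I" "finite Z" "\<And>j. j \<in> I \<Longrightarrow> finite (D j)" and Z: "Z \<noteq> {}"
    and D: "\<And>j. j \<in> I \<Longrightarrow> D j \<noteq> {}" and m: "card I \<le> m" "m \<ge> 1" and r: "0 < r" "r \<le> 1"
    and symR: "\<And>x y. R x y \<Longrightarrow> R y x"
    and deg: "\<And>j w. j \<in> I \<Longrightarrow> w \<in> D j \<Longrightarrow> r * card Z \<le> card {z\<in>Z. R w z}"
    and sparse: "(\<Sum>z\<in>Z. \<Prod>j\<in>I. real (card {y\<in>D j. R z y}))
      < (r / 2) ^ m / 2 * card Z * (\<Prod>j\<in>I. real (card (D j)))"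
  shows "\<exists>j\<in>I. \<exists>Z'\<subseteq>Z. \<exists>D'\<subseteq>D j. Z' \<noteq> {} \<and> r / 2 * card Z \<le> card Z' \<and>
    r / (8 * m) * card (D j) \<le> card D' \<and>
    (\<forall>w\<in>D'. r * (1 + 1 / (8 * m)) * card Z' \<le> card {z\<in>Z'. R w z})"
proof -
  define U where "U j = {z\<in>Z. real (card {y\<in>D j. R z y}) < r / 2 * card (D j)}" for j
  have finU: "finite (U j)" "U j \<subseteq> Z" for j using fin by (auto simp: U_def)
  have cZ: "real (card Z) > 0" using Z fin by (simp add: card_gt_0_iff)
  have cD: "real (card (D j)) > 0" if "j \<in> I" for j using D[OF that] fin(3)[OF that] by (simp add: card_gt_0_iff)
  have m0: "real m > 0" using m by simp
  \<comment> \<open>Otherwise half of \<open>Z\<close> has relative degree at least \<open>r / 2\<close> to every side of the box.\<close>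
  have "\<exists>j\<in>I. real (card (U j)) \<ge> card Z / (2 * m)"
  proof (rule ccontr)
    assume "\<not> ?thesis"
    then have small: "\<And>j. j \<in> I \<Longrightarrow> real (card (U j)) \<le> card Z / (2 * m)" by force
    define G where "G = Z - (\<Union>j\<in>I. U j)"
    have finUU: "finite (\<Union>j\<in>I. U j)" using fin finU by auto
    have "card (\<Union>j\<in>I. U j) \<le> (\<Sum>j\<in>I. card (U j))" using fin by (intro card_UN_le)
    then have "real (card (\<Union>j\<in>I. U j)) \<le> (\<Sum>j\<in>I. real (card (U j)))"
      by (simp only: of_nat_sum[symmetric] of_nat_le_iff)
    also have "\<dots> \<le> (\<Sum>j\<in>I. card Z / (2 * m))" by (intro sum_mono small)
    also have "\<dots> = card I * (card Z / (2 * m))" by simp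
    also have "\<dots> \<le> m * (card Z / (2 * m))" using m by (intro mult_right_mono) auto
    also have "\<dots> = card Z / 2" using m0 by simp
    finally have "real (card (\<Union>j\<in>I. U j)) \<le> card Z / 2" .
    moreover have "card Z \<le> card G + card (\<Union>j\<in>I. U j)"
    proof -
      have "card Z \<le> card (G \<union> (\<Union>j\<in>I. U j))"
        using fin finUU by (intro card_mono) (auto simp: G_def)
      also have "\<dots> \<le> card G + card (\<Union>j\<in>I. U j)" by (rule card_Un_le)
      finally show ?thesis .
    qed
    ultimately have G: "card Z / 2 \<le> card G" by linarith
    have each: "(r / 2) ^ m * (\<Prod>j\<in>I. real (card (D j))) \<le> (\<Prod>j\<in>I. real (card {y\<in>D j. R z y}))"
      if z: "z \<in> G" for z
    proof -
      have "(r / 2) ^ m \<le> (r / 2) ^ card I" using m r by (intro power_decreasing) auto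
      then have "(r / 2) ^ m * (\<Prod>j\<in>I. real (card (D j))) \<le> (r / 2) ^ card I * (\<Prod>j\<in>I. real (card (D j)))"
        by (intro mult_right_mono prod_nonneg) auto
      also have "\<dots> = (\<Prod>j\<in>I. r / 2 * real (card (D j)))" by (simp only: prod.distrib prod_constant)
      also have "\<dots> \<le> (\<Prod>j\<in>I. real (card {y\<in>D j. R z y}))"
        using z r by (intro prod_mono) (auto simp: G_def U_def not_less)
      finally show ?thesis .
    qed
    have "(r / 2) ^ m / 2 * card Z * (\<Prod>j\<in>I. real (card (D j)))
        = card Z / 2 * ((r / 2) ^ m * (\<Prod>j\<in>I. real (card (D j))))" by simp
    also have "\<dots> \<le> card G * ((r / 2) ^ m * (\<Prod>j\<in>I. real (card (D j))))"
      using G r by (intro mult_right_mono mult_nonneg_nonneg prod_nonneg) auto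
    also have "\<dots> = (\<Sum>z\<in>G. (r / 2) ^ m * (\<Prod>j\<in>I. real (card (D j))))" by simp
    also have "\<dots> \<le> (\<Sum>z\<in>G. \<Prod>j\<in>I. real (card {y\<in>D j. R z y}))" by (intro sum_mono each)
    also have "\<dots> \<le> (\<Sum>z\<in>Z. \<Prod>j\<in>I. real (card {y\<in>D j. R z y}))"
      using fin by (intro sum_mono2 prod_nonneg) (auto simp: G_def)
    finally show False using sparse by linarith
  qed
  then obtain j where j: "j \<in> I" and Uj: "real (card (U j)) \<ge> card Z / (2 * m)" by auto
  define Z' where "Z' = Z - U j"
  define d where "d = real (card (D j))"
  have d: "d > 0" using cD[OF j] by (simp add: d_def)
  have finZ': "finite Z'" "Z' \<subseteq> Z" using fin by (auto simp: Z'_def)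
  have ZU: "real (card Z) = card Z' + card (U j)"
    using fin finU card_mono[OF fin(2) finU(2)] by (simp add: Z'_def card_Diff_subset)
  define e where "e = (\<Sum>z\<in>Z'. real (card {y\<in>D j. R z y}))"
  have symset: "{z\<in>A. R z y} = {z\<in>A. R y z}" for A y using symR by blast
  have "(\<Sum>y\<in>D j. r * card Z) \<le> (\<Sum>y\<in>D j. real (card {z\<in>Z. R z y}))"
    using deg[OF j] by (intro sum_mono) (simp add: symset)
  then have "r * card Z * d \<le> (\<Sum>y\<in>D j. real (card {z\<in>Z. R z y}))"
    by (simp add: d_def mult_ac)
  also have "\<dots> = (\<Sum>z\<in>Z. real (card {y\<in>D j. R z y}))"
    using sum_degrees_swap[OF fin(2) fin(3)[OF j], of R] by (simp only: of_nat_sum[symmetric])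
  \<comment> \<open>The deleted vertices have at most half the average degree, so the edges to
    \<open>Z'\<close> exceed their fair share.\<close>
  also have "\<dots> = e + (\<Sum>z\<in>U j. real (card {y\<in>D j. R z y}))"
    unfolding e_def Z'_def by (rule sum.subset_diff) (use fin finU in auto)
  also have "(\<Sum>z\<in>U j. real (card {y\<in>D j. R z y})) \<le> (\<Sum>z\<in>U j. r / 2 * d)"
    by (intro sum_mono) (auto simp: U_def d_def)
  finally have "r * card Z * d \<le> e + card (U j) * (r / 2 * d)" by simp
  then have e_ge: "r * (card Z' + card (U j) / 2) * d \<le> e"
    unfolding ZU by (simp add: algebra_simps)
  have e_le: "e \<le> card Z' * d"
  proof -
    have "e \<le> (\<Sum>z\<in>Z'. d)" unfolding e_def d_def
      using fin(3)[OF j] by (intro sum_mono) (auto intro!: card_mono)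
    then show ?thesis by simp
  qed
  \<comment> \<open>Comparison with the trivial bound \<open>e_le\<close> shows that
    \<open>Z'\<close> is not small, however large \<open>U j\<close> may be.\<close>
  have "r / 2 * card Z * d \<le> r * (card Z' + card (U j) / 2) * d"
    unfolding ZU using r d by (intro mult_right_mono) (auto simp: algebra_simps)
  then have "(r / 2 * card Z) * d \<le> card Z' * d" using e_ge e_le by linarith
  then have Z'ge: "r / 2 * card Z \<le> card Z'" using d mult_le_cancel_right_pos by blast
  have "r / 2 * card Z > 0" using r cZ by simp
  then have "real (card Z') > 0" using Z'ge by linarith
  then have Z'ne: "Z' \<noteq> {}" by auto
  have "real (card Z') / (2 * m) \<le> card Z / (2 * m)" using ZU by (intro divide_right_mono) auto
  then have "real (card Z') / (2 * m) \<le> card (U j)" using Uj by linarith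
  then have "card Z' * (1 + 1 / (4 * m)) \<le> card Z' + card (U j) / 2"
    by (simp add: algebra_simps)
  then have "r * (card Z' * (1 + 1 / (4 * m))) * d \<le> r * (card Z' + card (U j) / 2) * d"
    using r d by (intro mult_right_mono mult_left_mono) auto
  \<comment> \<open>The gain \<open>1 / (4 * m)\<close> is split in two: one half raises the degree
    bound, the other becomes the share of \<open>D j\<close> that attains it.\<close>
  also have "r * (card Z' * (1 + 1 / (4 * m))) * d = (r * (1 + 1 / (8 * m)) + r / (8 * m)) * card Z' * d"
    using m0 by (simp add: field_simps)
  finally have "(r * (1 + 1 / (8 * m)) + r / (8 * m)) * card Z' * card (D j) \<le> e"
    using e_ge by (simp add: d_def)
  also have "e = (\<Sum>y\<in>D j. real (card {z\<in>Z'. R y z}))"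
    unfolding e_def using sum_degrees_swap[OF finZ'(1) fin(3)[OF j], of R]
    by (simp only: of_nat_sum[symmetric] symset)
  finally have "r / (8 * m) * card (D j)
      \<le> card {y\<in>D j. real (card {z\<in>Z'. R y z}) \<ge> r * (1 + 1 / (8 * m)) * card Z'}"
    by (intro card_high_degree_ge) (use fin(3)[OF j] finZ' Z'ne r in auto)
  then show ?thesis
    using j finZ' Z'ne Z'ge
    by (intro bexI[of _ j] exI[of _ Z'] conjI
        exI[of _ "{y\<in>D j. real (card {z\<in>Z'. R y z}) \<ge> r * (1 + 1 / (8 * m)) * card Z'}"]) auto
qed


section \<open>Extending homomorphisms by one vertex\<close>

text \<open>First the independent set \<open>{a}\<close> is split off. For a fixed image
  \<open>z\<close> of \<open>a\<close>, the vertices of \<open>I\<close> must map to neighbours of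
  \<open>z\<close>, which only cuts down the parts in \<open>I\<close>; so the splitting along
  \<open>I\<close> applies again.\<close>

lemma card_homs_insert:
  fixes E :: "'a \<Rightarrow> 'a \<Rightarrow> bool" and R :: "'b \<Rightarrow> 'b \<Rightarrow> bool"
  assumes finS: "finite S" and finY: "\<And>v. v \<in> S \<Longrightarrow> finite (Y v)" and finZ: "finite Z" and a: "a \<notin> S"
    and symE: "\<And>u v. E u v \<Longrightarrow> E v u" and irr: "\<And>v. \<not> E v v"
    and tf: "\<And>x y z. E x y \<Longrightarrow> E y z \<Longrightarrow> \<not> E x z"
    and symR: "\<And>x y. R x y \<Longrightarrow> R y x"
    and I: "I = {j\<in>S. E a j}" and J: "J = S - I"
  shows "card (homs (insert a S) E R (Y(a := Z)))
    = (\<Sum>\<omega>\<in>homs J E R Y. \<Sum>z\<in>Z. \<Prod>j\<in>I. card {y \<in> common_nbrs J E R Y \<omega> j. R z y})"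
proof -
  let ?Y = "Y(a := Z)"
  have S: "I \<union> J = S" "I \<inter> J = {}" and finIJ: "finite I" "finite J"
    using finS I J by auto
  have indep: "\<And>u v. u \<in> I \<Longrightarrow> v \<in> I \<Longrightarrow> \<not> E u v" using tf I by auto
  have finH: "finite (homs S E R Y)" using finS finY by (intro finite_homs)
  have eqS: "homs S E R ?Y = homs S E R Y" using a by (intro homs_cong) auto
  define Yz where "Yz z j = (if j \<in> I then {y\<in>Y j. R z y} else Y j)" for z j
  have "card (homs (insert a S) E R ?Y) = card (homs ({a} \<union> S) E R ?Y)" by simp
  also have "\<dots> = (\<Sum>\<omega>\<in>homs S E R ?Y. \<Prod>j\<in>{a}. card (common_nbrs S E R ?Y \<omega> j))"
    by (rule card_homs_split(1)) (use finS finY finZ a irr symE symR in auto)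
  also have "\<dots> = (\<Sum>\<omega>\<in>homs S E R Y. card {z\<in>Z. \<forall>j\<in>I. R z (\<omega> j)})"
    unfolding eqS
  proof (rule sum.cong[OF refl])
    fix \<omega>
    have "common_nbrs S E R ?Y \<omega> a = {z\<in>Z. \<forall>j\<in>I. R z (\<omega> j)}"
      using I symE symR unfolding common_nbrs_def by auto
    then show "(\<Prod>j\<in>{a}. card (common_nbrs S E R ?Y \<omega> j)) = card {z\<in>Z. \<forall>j\<in>I. R z (\<omega> j)}" by simp
  qed
  also have "\<dots> = (\<Sum>z\<in>Z. card {\<omega>\<in>homs S E R Y. \<forall>j\<in>I. R z (\<omega> j)})"
    by (rule sum_degrees_swap[OF finH finZ])
  also have "\<dots> = (\<Sum>z\<in>Z. \<Sum>\<omega>\<in>homs J E R Y. \<Prod>j\<in>I. card {y \<in> common_nbrs J E R Y \<omega> j. R z y})"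
  proof (rule sum.cong[OF refl])
    fix z
    have "{\<omega>\<in>homs S E R Y. \<forall>j\<in>I. R z (\<omega> j)} = homs (I \<union> J) E R (Yz z)"
      unfolding S homs_def Yz_def using I by (auto simp: PiE_iff)
    also have "card \<dots> = (\<Sum>\<omega>\<in>homs J E R (Yz z). \<Prod>j\<in>I. card (common_nbrs J E R (Yz z) \<omega> j))"
      by (rule card_homs_split(1)) (use finIJ S finY indep symE symR in \<open>auto simp: Yz_def\<close>)
    also have "homs J E R (Yz z) = homs J E R Y" using J by (intro homs_cong) (auto simp: Yz_def)
    also have "(\<Sum>\<omega>\<in>homs J E R Y. \<Prod>j\<in>I. card (common_nbrs J E R (Yz z) \<omega> j))
        = (\<Sum>\<omega>\<in>homs J E R Y. \<Prod>j\<in>I. card {y \<in> common_nbrs J E R Y \<omega> j. R z y})"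
      by (intro sum.cong prod.cong refl arg_cong[where f = card]) (auto simp: common_nbrs_def Yz_def)
    finally show "card {\<omega>\<in>homs S E R Y. \<forall>j\<in>I. R z (\<omega> j)}
      = (\<Sum>\<omega>\<in>homs J E R Y. \<Prod>j\<in>I. card {y \<in> common_nbrs J E R Y \<omega> j. R z y})" .
  qed
  also have "\<dots> = (\<Sum>\<omega>\<in>homs J E R Y. \<Sum>z\<in>Z. \<Prod>j\<in>I. card {y \<in> common_nbrs J E R Y \<omega> j. R z y})"
    by (rule sum.swap)
  finally show ?thesis .
qed

text \<open>The box of \<open>\<omega>\<close> consists of the extensions of \<open>\<omega>\<close> to \<open>I\<close>. If no box of at least half the
  expected relative size is sparse towards \<open>Z\<close>, averaging over these boxes makes \<open>insert a S\<close> dense.\<close>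

lemma homs_insert_or_sparse_box:
  fixes E :: "'a \<Rightarrow> 'a \<Rightarrow> bool" and R :: "'b \<Rightarrow> 'b \<Rightarrow> bool" and \<epsilon> p :: real
  assumes finS: "finite S" and finY: "\<And>v. v \<in> S \<Longrightarrow> finite (Y v)" and finZ: "finite Z" and a: "a \<notin> S"
    and symE: "\<And>u v. E u v \<Longrightarrow> E v u" and irr: "\<And>v. \<not> E v v"
    and tf: "\<And>x y z. E x y \<Longrightarrow> E y z \<Longrightarrow> \<not> E x z"
    and symR: "\<And>x y. R x y \<Longrightarrow> R y x"
    and I: "I = {j\<in>S. E a j}" and J: "J = S - I"
    and \<epsilon>: "\<epsilon> > 0" and p: "p \<ge> 0"
    and dense: "\<epsilon> * (\<Prod>v\<in>S. real (card (Y v))) \<le> card (homs S E R Y)"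
    and not_dense: "card (homs (insert a S) E R (Y(a := Z)))
      < \<epsilon> * p / 2 * (\<Prod>v\<in>insert a S. real (card ((Y(a := Z)) v)))"
  shows "\<exists>\<omega>. (\<epsilon> / 2) * (\<Prod>j\<in>I. real (card (Y j))) \<le> (\<Prod>j\<in>I. real (card (common_nbrs J E R Y \<omega> j)))
    \<and> (\<Sum>z\<in>Z. \<Prod>j\<in>I. real (card {y \<in> common_nbrs J E R Y \<omega> j. R z y}))
       < p * card Z * (\<Prod>j\<in>I. real (card (common_nbrs J E R Y \<omega> j)))"
proof (rule ccontr)
  assume neg: "\<not> ?thesis"
  have S: "I \<union> J = S" "I \<inter> J = {}" and finIJ: "finite I" "finite J"
    using finS I J by auto
  have indep: "\<And>u v. u \<in> I \<Longrightarrow> v \<in> I \<Longrightarrow> \<not> E u v" using tf I by auto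
  define \<Omega> where "\<Omega> = homs J E R Y"
  define box where "box \<omega> = (\<Prod>j\<in>I. real (card (common_nbrs J E R Y \<omega> j)))" for \<omega>
  define ext where "ext \<omega> = (\<Sum>z\<in>Z. \<Prod>j\<in>I. real (card {y \<in> common_nbrs J E R Y \<omega> j. R z y}))" for \<omega>
  define PI where "PI = (\<Prod>j\<in>I. real (card (Y j)))"
  define PJ where "PJ = (\<Prod>j\<in>J. real (card (Y j)))"
  have pos: "PI \<ge> 0" "PJ \<ge> 0" by (auto simp: PI_def PJ_def intro: prod_nonneg)
  have PS: "(\<Prod>v\<in>S. real (card (Y v))) = PI * PJ"
    unfolding S(1)[symmetric] PI_def PJ_def by (rule prod.union_disjoint) (use finIJ S in auto)
  have fin\<Omega>: "finite \<Omega>" unfolding \<Omega>_def using finIJ finY S(1) by (intro finite_homs) auto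
  have neg': "p * card Z * box \<omega> \<le> ext \<omega>" if "\<epsilon> / 2 * PI \<le> box \<omega>" for \<omega>
    using neg that by (force simp: box_def ext_def PI_def)
  have "card (homs S E R Y) = (\<Sum>\<omega>\<in>\<Omega>. \<Prod>j\<in>I. card (common_nbrs J E R Y \<omega> j))"
    unfolding \<Omega>_def S(1)[symmetric]
    by (rule card_homs_split(1)) (use finIJ finY S indep symE symR in auto)
  then have homS: "real (card (homs S E R Y)) = sum box \<Omega>" by (simp add: box_def)
  have "card \<Omega> \<le> card (PiE J Y)"
    unfolding \<Omega>_def using finIJ finY S(1) by (intro card_mono finite_PiE homs_subset) auto
  also have "\<dots> = (\<Prod>j\<in>J. card (Y j))" using finIJ by (simp add: card_PiE)
  finally have \<Omega>J: "real (card \<Omega>) \<le> PJ"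
    unfolding PJ_def by (simp only: of_nat_prod[symmetric] of_nat_le_iff)
  \<comment> \<open>Subtracting half the expected box size makes the lower bound nonpositive on
    small boxes, so it holds for every \<open>\<omega>\<close>.\<close>
  have "sum box \<Omega> - card \<Omega> * (\<epsilon> / 2 * PI) = (\<Sum>\<omega>\<in>\<Omega>. box \<omega> - \<epsilon> / 2 * PI)"
    by (simp add: sum_subtractf)
  then have "p * card Z * (sum box \<Omega> - card \<Omega> * (\<epsilon> / 2 * PI))
      = (\<Sum>\<omega>\<in>\<Omega>. p * card Z * (box \<omega> - \<epsilon> / 2 * PI))"
    by (simp only: sum_distrib_left)
  also have "\<dots> \<le> sum ext \<Omega>"
  proof (rule sum_mono)
    fix \<omega>
    show "p * card Z * (box \<omega> - \<epsilon> / 2 * PI) \<le> ext \<omega>"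
    proof (cases "\<epsilon> / 2 * PI \<le> box \<omega>")
      case True
      have "p * card Z * (box \<omega> - \<epsilon> / 2 * PI) \<le> p * card Z * box \<omega>"
        using p \<epsilon> pos by (intro mult_left_mono) auto
      then show ?thesis using neg'[OF True] by linarith
    next
      case False
      then have "p * card Z * (box \<omega> - \<epsilon> / 2 * PI) \<le> 0"
        using p by (intro mult_nonneg_nonpos) auto
      moreover have "ext \<omega> \<ge> 0" by (auto simp: ext_def intro!: sum_nonneg prod_nonneg)
      ultimately show ?thesis by linarith
    qed
  qed
  also have "sum ext \<Omega> = card (homs (insert a S) E R (Y(a := Z)))"
  proof -
    have "card (homs (insert a S) E R (Y(a := Z)))
        = (\<Sum>\<omega>\<in>\<Omega>. \<Sum>z\<in>Z. \<Prod>j\<in>I. card {y \<in> common_nbrs J E R Y \<omega> j. R z y})"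
      unfolding \<Omega>_def
      by (rule card_homs_insert) (fact finS finY finZ a symE irr tf symR I J)+
    then show ?thesis by (simp add: ext_def)
  qed
  finally have ge: "p * card Z * (sum box \<Omega> - card \<Omega> * (\<epsilon> / 2 * PI))
      \<le> card (homs (insert a S) E R (Y(a := Z)))" .
  \<comment> \<open>There are at most \<open>PJ\<close> boxes, so the subtraction costs at most half
    of the count guaranteed by \<open>dense\<close>.\<close>
  have "card \<Omega> * (\<epsilon> / 2 * PI) \<le> PJ * (\<epsilon> / 2 * PI)"
    using \<Omega>J \<epsilon> pos by (intro mult_right_mono) auto
  then have "\<epsilon> / 2 * (PI * PJ) \<le> sum box \<Omega> - card \<Omega> * (\<epsilon> / 2 * PI)"
    using dense unfolding PS homS by (simp add: algebra_simps)
  then have "p * card Z * (\<epsilon> / 2 * (PI * PJ)) \<le> p * card Z * (sum box \<Omega> - card \<Omega> * (\<epsilon> / 2 * PI))"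
    using p by (intro mult_left_mono) auto
  also have "p * card Z * (\<epsilon> / 2 * (PI * PJ)) = \<epsilon> * p / 2 * (\<Prod>v\<in>insert a S. real (card ((Y(a := Z)) v)))"
  proof -
    have "(\<Prod>v\<in>S. real (card ((Y(a := Z)) v))) = (\<Prod>v\<in>S. real (card (Y v)))"
      using a by (intro prod.cong) auto
    then show ?thesis using finS a by (simp add: PS)
  qed
  finally show False using ge not_dense by linarith
qed

section \<open>Dense colours\<close>

text \<open>The dense pair \<open>(X, X')\<close> serves to start the degree condition of a colour whose density is
  used for the first time.\<close>

definition dense_colour :: "'a set \<Rightarrow> ('a \<Rightarrow> 'a \<Rightarrow> bool) \<Rightarrow> real \<Rightarrow> real \<Rightarrow> nat \<Rightarrow> ('b \<Rightarrow> 'b \<Rightarrow> nat) \<Rightarrow> 'b set \<Rightarrow> bool"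
  where "dense_colour S E \<epsilon> M q \<chi> W \<longleftrightarrow> (\<exists>c<q. \<exists>X X' Y.
    X \<subseteq> W \<and> X' \<subseteq> W \<and> X \<inter> X' = {} \<and> real (card W) \<le> M * card X \<and> real (card W) \<le> M * card X' \<and>
    \<epsilon> * real (card X) * real (card X') \<le> (\<Sum>x\<in>X'. real (card {y\<in>X. \<chi> x y = c})) \<and>
    (\<forall>v\<in>S. Y v \<subseteq> W \<and> real (card W) \<le> M * card (Y v)) \<and> disjoint_family_on Y S \<and>
    \<epsilon> * (\<Prod>v\<in>S. real (card (Y v))) \<le> real (card (homs S E (\<lambda>x y. \<chi> x y = c) Y)))"

lemma dense_colourI:
  fixes \<epsilon> M :: real
  assumes "c < q" "X \<subseteq> W" "X' \<subseteq> W" "X \<inter> X' = {}"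
    "real (card W) \<le> M * card X" "real (card W) \<le> M * card X'"
    "\<epsilon> * card X * card X' \<le> (\<Sum>x\<in>X'. real (card {y\<in>X. \<chi> x y = c}))"
    "\<forall>v\<in>S. Y v \<subseteq> W \<and> real (card W) \<le> M * card (Y v)" "disjoint_family_on Y S"
    "\<epsilon> * (\<Prod>v\<in>S. real (card (Y v))) \<le> card (homs S E (\<lambda>x y. \<chi> x y = c) Y)"
  shows "dense_colour S E \<epsilon> M q \<chi> W"
  unfolding dense_colour_def
  by (rule exI[of _ c], rule conjI, rule assms, rule exI[of _ X], rule exI[of _ X'], rule exI[of _ Y])
    (use assms in simp)

lemma dense_colour_mono:
  fixes \<epsilon> \<epsilon>' M M' :: real
  assumes "dense_colour S E \<epsilon> M q \<chi> W" and "\<epsilon>' \<le> \<epsilon>" "M \<le> M'"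
  shows "dense_colour S E \<epsilon>' M' q \<chi> W"
proof -
  have 1: "x \<le> M' * real y" if "x \<le> M * real y" for x y
    using that mult_right_mono[OF assms(3), of "real y"] by linarith
  have 2: "\<epsilon>' * real x * real y \<le> z" if "\<epsilon> * real x * real y \<le> z" for x y z
    using that mult_right_mono[OF assms(2), of "real x * real y"] by (simp add: mult.assoc)
  have 3: "\<epsilon>' * (\<Prod>v\<in>S. real (f v)) \<le> z" if "\<epsilon> * (\<Prod>v\<in>S. real (f v)) \<le> z" for f z
    using that mult_right_mono[OF assms(2), of "\<Prod>v\<in>S. real (f v)"] by (simp add: prod_nonneg)
  from assms(1) obtain c X X' Y where "c < q" "X \<subseteq> W" "X' \<subseteq> W" "X \<inter> X' = {}"
    "real (card W) \<le> M * card X" "real (card W) \<le> M * card X'"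
    "\<epsilon> * real (card X) * real (card X') \<le> (\<Sum>x\<in>X'. real (card {y\<in>X. \<chi> x y = c}))"
    "\<forall>v\<in>S. Y v \<subseteq> W \<and> real (card W) \<le> M * card (Y v)" "disjoint_family_on Y S"
    "\<epsilon> * (\<Prod>v\<in>S. real (card (Y v))) \<le> real (card (homs S E (\<lambda>x y. \<chi> x y = c) Y))"
    unfolding dense_colour_def by blast
  then show ?thesis using 1 2 3
    by (intro dense_colourI[where c = c and X = X and X' = X' and Y = Y]) blast+
qed

text \<open>Without vertices only the dense pair has content. Halving \<open>W\<close> and taking a
  colour of at least average frequency between the halves gives density \<open>1 / q\<close>; the
  factor 4 leaves room for rounding.\<close>

lemma dense_colour_empty:
  fixes \<chi> :: "'b \<Rightarrow> 'b \<Rightarrow> nat"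
  assumes W: "finite W" "card W \<ge> 4" and q: "q \<ge> 1" and \<chi>: "\<And>x y. \<chi> x y < q"
  shows "dense_colour {} E (1 / q) 4 q \<chi> W"
proof -
  obtain X where X: "X \<subseteq> W" "card X = card W div 2"
    using obtain_subset_with_card_n[of "card W div 2" W] by (metis div_le_dividend)
  define X' where "X' = W - X"
  have finX: "finite X" "finite X'" using X W finite_subset by (auto simp: X'_def)
  have X': "card X' = card W - card W div 2"
    unfolding X'_def using X finX by (simp add: card_Diff_subset)
  have big: "card W \<le> 4 * card X" "card W \<le> 4 * card X'" using X X' W by auto
  define d where "d c = (\<Sum>x\<in>X'. card {y\<in>X. \<chi> x y = c})" for c
  have "(\<Sum>c<q. d c) = (\<Sum>x\<in>X'. \<Sum>c<q. card {y\<in>X. \<chi> x y = c})"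
    unfolding d_def by (rule sum.swap)
  also have "\<dots> = (\<Sum>x\<in>X'. card X)"
  proof (rule sum.cong[OF refl])
    fix x
    have "(\<Sum>c<q. card {y\<in>X. \<chi> x y = c}) = card (\<Union>c<q. {y\<in>X. \<chi> x y = c})"
      using finX by (intro card_UN_disjoint[symmetric]) auto
    also have "(\<Union>c<q. {y\<in>X. \<chi> x y = c}) = X" using \<chi> by auto
    finally show "(\<Sum>c<q. card {y\<in>X. \<chi> x y = c}) = card X" .
  qed
  finally have total: "(\<Sum>c<q. d c) = card X' * card X" by simp
  have "\<exists>c<q. card X' * card X \<le> q * d c"
  proof (rule ccontr)
    assume "\<not> ?thesis"
    then have lt: "\<And>c. c < q \<Longrightarrow> q * d c < card X' * card X" by (metis not_less)
    have "(\<Sum>c<q. q * d c) < (\<Sum>c<q. card X' * card X)"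
      by (rule sum_strict_mono) (use q lt in \<open>auto simp: lessThan_empty_iff\<close>)
    then show False using total by (simp add: sum_distrib_left[symmetric])
  qed
  then obtain c where c: "c < q" "card X' * card X \<le> q * d c" by auto
  have "real (card X') * real (card X) \<le> real q * real (d c)"
    using c(2) by (simp only: of_nat_mult[symmetric] of_nat_le_iff)
  then have dens: "1 / q * card X * card X' \<le> (\<Sum>x\<in>X'. real (card {y\<in>X. \<chi> x y = c}))"
    using q by (simp add: d_def field_simps)
  have hom: "homs {} E (\<lambda>x y. \<chi> x y = c) (\<lambda>_. {}) = {\<lambda>_. undefined}" by (auto simp: homs_def)
  show ?thesis
  proof (rule dense_colourI[where c = c and X = X and X' = X' and Y = "\<lambda>_. {}"])
    show "real (card W) \<le> 4 * real (card X)" "real (card W) \<le> 4 * real (card X')" using big by linarith+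
    show "1 / real q * (\<Prod>v\<in>{}. real (card {})) \<le> real (card (homs {} E (\<lambda>x y. \<chi> x y = c) (\<lambda>_. {})))"
      using q by (simp add: hom)
  qed (use c X dens in \<open>auto simp: X'_def disjoint_family_on_def\<close>)
qed


section \<open>Iterating the increment over all colours\<close>

text \<open>State of the density increment: \<open>l c\<close> counts the increments of colour \<open>c\<close> and \<open>r t\<close> is the
  degree bound after \<open>t\<close> of them; \<open>Z c\<close> is meaningless while \<open>l c = 0\<close>. Each increment costs at
  most a factor \<open>K\<close> in size.\<close>

definition config :: "nat \<Rightarrow> ('b \<Rightarrow> 'b \<Rightarrow> nat) \<Rightarrow> (nat \<Rightarrow> real) \<Rightarrow> 'b set \<Rightarrow> real \<Rightarrow>
    (nat \<Rightarrow> nat) \<Rightarrow> (nat \<Rightarrow> 'b set) \<Rightarrow> 'b set \<Rightarrow> bool"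
  where "config q \<chi> r W K l Z W' \<longleftrightarrow> W' \<subseteq> W \<and> real (card W) \<le> K ^ (\<Sum>c<q. l c) * card W' \<and>
    (\<forall>c<q. 0 < l c \<longrightarrow> Z c \<subseteq> W \<and> Z c \<inter> W' = {} \<and> Z c \<noteq> {} \<and>
      real (card W) \<le> K ^ (\<Sum>c<q. l c) * card (Z c) \<and>
      (\<forall>w\<in>W'. r (l c) * card (Z c) \<le> card {z\<in>Z c. \<chi> w z = c}))"

text \<open>Passing to a subset \<open>W''\<close> keeps the degree conditions of all other colours,
  so a step only has to supply new data for \<open>c\<close>. Sizes are measured against the
  original \<open>W\<close>, and one more factor \<open>K\<close> pays for the step.\<close>

lemma config_update:
  assumes conf: "config q \<chi> r W K l Z W'" and c: "c < q" and K: "K \<ge> 1"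
    and W'': "W'' \<subseteq> W'" "real (card W') \<le> K * card W''"
    and Z0: "Z0 \<subseteq> W" "Z0 \<inter> W'' = {}" "Z0 \<noteq> {}" "real (card W) \<le> K ^ Suc (\<Sum>c<q. l c) * card Z0"
    and deg: "\<And>w. w \<in> W'' \<Longrightarrow> r (Suc (l c)) * card Z0 \<le> card {z\<in>Z0. \<chi> w z = c}"
  shows "\<exists>l' Z' W''. config q \<chi> r W K l' Z' W'' \<and> (\<Sum>c<q. l' c) = Suc (\<Sum>c<q. l c)"
proof -
  define s where "s = (\<Sum>c<q. l c)"
  let ?l = "l(c := Suc (l c))"
  have "(\<Sum>c'<q. ?l c') = ?l c + (\<Sum>c'\<in>{..<q} - {c}. ?l c')"
    using c by (intro sum.remove) auto
  also have "(\<Sum>c'\<in>{..<q} - {c}. ?l c') = (\<Sum>c'\<in>{..<q} - {c}. l c')"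
    by (rule sum.cong) auto
  also have "?l c + (\<Sum>c'\<in>{..<q} - {c}. l c') = Suc s"
    using c sum.remove[of "{..<q}" c l] by (simp add: s_def)
  finally have sum: "(\<Sum>c'<q. ?l c') = Suc s" .
  have Ks: "K ^ s * x \<le> K ^ Suc s * x" if "x \<ge> 0" for x
    using that K by (intro mult_right_mono power_increasing) auto
  have "real (card W) \<le> K ^ s * card W'" using conf by (simp add: config_def s_def)
  also have "\<dots> \<le> K ^ s * (K * card W'')" using W'' K by (intro mult_left_mono) auto
  finally have WW: "real (card W) \<le> K ^ Suc s * card W''" by (simp add: mult_ac)
  have "config q \<chi> r W K ?l (Z(c := Z0)) W''"
    unfolding config_def sum
  proof (intro conjI allI impI)
    show "W'' \<subseteq> W" using W'' conf by (auto simp: config_def)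
    show "real (card W) \<le> K ^ Suc s * card W''" by (rule WW)
  next
    fix c' assume c': "c' < q" "0 < ?l c'"
    have old: "Z c' \<subseteq> W" "Z c' \<inter> W' = {}" "Z c' \<noteq> {}" if "c' \<noteq> c"
      using conf c' that by (simp_all add: config_def)
    show "(Z(c := Z0)) c' \<subseteq> W" using Z0 old by (cases "c' = c") simp_all
    show "(Z(c := Z0)) c' \<noteq> {}" using Z0 old by (cases "c' = c") simp_all
    show "(Z(c := Z0)) c' \<inter> W'' = {}"
    proof (cases "c' = c")
      case False
      then show ?thesis using old(2) W''(1) by auto
    qed (use Z0 in simp)
    show "real (card W) \<le> K ^ Suc s * card ((Z(c := Z0)) c')"
    proof (cases "c' = c")
      case False
      then have "real (card W) \<le> K ^ s * card (Z c')" using conf c' by (simp add: config_def s_def)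
      then show ?thesis using False Ks[of "card (Z c')"] by simp
    qed (use Z0 in \<open>simp add: s_def\<close>)
    show "\<forall>w\<in>W''. r (?l c') * card ((Z(c := Z0)) c') \<le> card {z\<in>(Z(c := Z0)) c'. \<chi> w z = c'}"
    proof (cases "c' = c")
      case False
      then show ?thesis using conf c' W''(1) by (auto simp: config_def)
    qed (use deg in auto)
  qed
  then show ?thesis using sum by (metis s_def)
qed

text \<open>The hypothesis for \<open>S\<close> inside \<open>W'\<close> yields a colour
  \<open>c\<close>. If \<open>c\<close> is new, its dense pair supplies the first
  \<open>Z c\<close>. Otherwise \<open>Z c\<close> is tried as the part for \<open>a\<close>; since
  this must fail, some box is sparse and permits a density increment.\<close>

lemma config_step:
  fixes E :: "'a \<Rightarrow> 'a \<Rightarrow> bool" and \<chi> :: "'b \<Rightarrow> 'b \<Rightarrow> nat" and \<epsilon> \<rho> M K :: real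
  assumes finS: "finite S" and a: "a \<notin> S"
    and symE: "\<And>u v. E u v \<Longrightarrow> E v u" and irr: "\<And>v. \<not> E v v"
    and tf: "\<And>x y z. E x y \<Longrightarrow> E y z \<Longrightarrow> \<not> E x z"
    and sym\<chi>: "\<And>x y. \<chi> x y = \<chi> y x" and finW: "finite W"
    and \<epsilon>: "0 < \<epsilon>" "\<epsilon> \<le> 1" and \<rho>: "0 < \<rho>" "\<rho> \<le> \<epsilon> / 2" and m: "m = Suc (card S)" and M: "M \<ge> 1"
    and r: "r = (\<lambda>t. \<rho> * (1 + 1 / (8 * real m)) ^ (t - 1))"
    and K: "K = 16 * real m * M / (\<rho> * \<epsilon>)"
    and conf: "config q \<chi> r W K l Z W'" and W': "W' \<noteq> {}"
    and IH: "dense_colour S E \<epsilon> M q \<chi> W'"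
    and nd: "\<not> dense_colour (insert a S) E (\<epsilon> * ((\<rho> / 2) ^ m / 2) / 2) (M * K ^ (\<Sum>c<q. l c)) q \<chi> W"
  shows "\<exists>l' Z' W''. config q \<chi> r W K l' Z' W'' \<and> (\<Sum>c<q. l' c) = Suc (\<Sum>c<q. l c)"
proof -
  define s where "s = (\<Sum>c<q. l c)"
  have W'sub: "W' \<subseteq> W" and WW': "real (card W) \<le> K ^ s * card W'"
    using conf by (auto simp: config_def s_def)
  have finW': "finite W'" using W'sub finW finite_subset by blast
  have cW': "real (card W') > 0" using W' finW' by (simp add: card_gt_0_iff)
  have m1: "real m \<ge> 1" using m by simp
  have \<rho>1: "\<rho> \<le> 1" using \<rho> \<epsilon> by linarith
  \<comment> \<open>\<open>K\<close> covers all losses of one step: \<open>M\<close> for the part,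
    \<open>\<epsilon> / 2\<close> for a side of the box, and \<open>\<rho> / (8 * m)\<close> for the
    high-degree share of that side.\<close>
  have K16: "16 * real m * M = K * \<rho> * \<epsilon>" using K \<rho> \<epsilon> by simp
  have "16 * real m * M \<ge> 16 * 1 * 1" using m1 M by (intro mult_mono) auto
  then have K\<rho>\<epsilon>: "K * \<rho> * \<epsilon> \<ge> 16" using K16 by simp
  have K0: "K > 0" unfolding K using m1 M \<rho> \<epsilon> by simp
  have K\<rho>: "K * \<rho> * \<epsilon> \<le> K * \<rho> * 1" using \<epsilon> K0 \<rho> by (intro mult_left_mono) auto
  have "K * \<rho> \<le> K * 1" using \<rho>1 K0 by (intro mult_left_mono) auto
  then have K1: "K \<ge> 1" using K\<rho> K\<rho>\<epsilon> by simp
  have "1 * M \<le> 16 * real m * M" using m1 M by (intro mult_right_mono) auto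
  then have KM\<rho>: "M \<le> K * \<rho>" using K\<rho> K16 by linarith
  obtain c X X' Y where c: "c < q" and X: "X \<subseteq> W'" "X' \<subseteq> W'" "X \<inter> X' = {}"
    and Xc: "real (card W') \<le> M * card X" "real (card W') \<le> M * card X'"
    and Xd: "\<epsilon> * card X * card X' \<le> (\<Sum>x\<in>X'. real (card {y\<in>X. \<chi> x y = c}))"
    and Y': "\<forall>v\<in>S. Y v \<subseteq> W' \<and> real (card W') \<le> M * card (Y v)"
    and Yd: "disjoint_family_on Y S"
    and hom: "\<epsilon> * (\<Prod>v\<in>S. real (card (Y v))) \<le> card (homs S E (\<lambda>x y. \<chi> x y = c) Y)"
    using IH unfolding dense_colour_def by blast
  have Y: "Y v \<subseteq> W'" "real (card W') \<le> M * card (Y v)" if "v \<in> S" for v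
    using Y' that by auto
  have finX: "finite X" "finite X'" using X finW' finite_subset by blast+
  have finY: "finite (Y v)" if "v \<in> S" for v using Y(1)[OF that] finW' finite_subset by blast
  have Xne: "X \<noteq> {}" using Xc cW' by auto
  show ?thesis
  proof (cases "l c = 0")
    case True
    define W'' where "W'' = {x\<in>X'. real (card {y\<in>X. \<chi> x y = c}) \<ge> \<rho> * card X}"
    \<comment> \<open>Of the density \<open>\<epsilon>\<close>, one \<open>\<rho>\<close> is kept as
      the degree bound and another as the share of \<open>X'\<close> attaining it.\<close>
    have "(\<rho> + \<rho>) * card X * card X' \<le> \<epsilon> * card X * card X'"
      using \<rho> by (intro mult_right_mono) auto
    then have "\<rho> * card X' \<le> card W''"
      unfolding W''_def using finX Xne \<rho> Xd by (intro card_high_degree_ge) auto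
    have "real (card W') \<le> M * card X'" by (rule Xc)
    also have "\<dots> \<le> K * \<rho> * card X'" using KM\<rho> by (intro mult_right_mono) auto
    also have "\<dots> = K * (\<rho> * card X')" by simp
    also have "\<dots> \<le> K * card W''" using \<open>\<rho> * card X' \<le> card W''\<close> K0 by (intro mult_left_mono) auto
    finally have W''c: "real (card W') \<le> K * card W''" .
    have "M \<le> K * 1" using KM\<rho> \<rho>1 K0 mult_left_mono[OF \<rho>1, of K] by linarith
    then have "M * card X \<le> K * card X" by (intro mult_right_mono) auto
    then have "real (card W') \<le> K * card X" using Xc by linarith
    then have "K ^ s * card W' \<le> K ^ s * (K * card X)" using K0 by (intro mult_left_mono) auto
    then have Xs: "real (card W) \<le> K ^ Suc s * card X" using WW' by (simp add: mult_ac)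
    show ?thesis
    proof (rule config_update[OF conf c K1 _ W''c, of X])
      show "W'' \<subseteq> W'" using X by (auto simp: W''_def)
      show "X \<subseteq> W" using X W'sub by auto
      show "X \<inter> W'' = {}" using X by (auto simp: W''_def)
      show "real (card W) \<le> K ^ Suc (\<Sum>c<q. l c) * card X" using Xs by (simp add: s_def)
      \<comment> \<open>The exponent \<open>t - 1\<close> vanishes at \<open>t = 1\<close>, so the
        first bound is exactly \<open>\<rho>\<close>.\<close>
      show "r (Suc (l c)) * card X \<le> card {z\<in>X. \<chi> w z = c}" if "w \<in> W''" for w
        using that True r by (simp add: W''_def)
    qed (rule Xne)
  next
    case False
    define R where "R x y \<longleftrightarrow> \<chi> x y = c" for x y
    have symR: "\<And>x y. R x y \<Longrightarrow> R y x" using sym\<chi> by (auto simp: R_def)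
    have Rc: "(\<lambda>x y. \<chi> x y = c) = R" by (auto simp: R_def fun_eq_iff)
    define I where "I = {j\<in>S. E a j}"
    define J where "J = S - I"
    let ?Z = "Z c"
    have Zc: "?Z \<subseteq> W" "?Z \<inter> W' = {}" "?Z \<noteq> {}" "real (card W) \<le> K ^ s * card ?Z"
      and deg: "\<And>w. w \<in> W' \<Longrightarrow> r (l c) * card ?Z \<le> card {z\<in>?Z. R w z}"
      using conf c False by (auto simp: config_def R_def s_def)
    have finZ: "finite ?Z" using Zc finW finite_subset by blast
    have cZ: "real (card ?Z) > 0" using finZ Zc by (simp add: card_gt_0_iff)
    define \<sigma> where "\<sigma> = r (l c)"
    have "1 \<le> (1 + 1 / (8 * real m)) ^ (l c - 1)" by (intro one_le_power) auto
    then have \<sigma>\<rho>: "\<rho> \<le> \<sigma>" unfolding \<sigma>_def r using \<rho> mult_left_mono[of 1 _ \<rho>] by simp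
    \<comment> \<open>Any vertex of \<open>W'\<close> shows that the degree bound is at most 1, as
      \<open>density_increment\<close> requires.\<close>
    obtain w0 where w0: "w0 \<in> W'" using W' by auto
    have "card {z\<in>?Z. R w0 z} \<le> card ?Z" using finZ by (intro card_mono) auto
    then have "\<sigma> * card ?Z \<le> 1 * real (card ?Z)" using deg[OF w0] by (simp add: \<sigma>_def)
    then have \<sigma>1: "\<sigma> \<le> 1" using cZ mult_le_cancel_right_pos by blast
    define p where "p = (\<rho> / 2) ^ m / 2"
    have p0: "p > 0" using \<rho> by (simp add: p_def)
    have p1: "p \<le> 1"
      unfolding p_def using \<rho> \<rho>1 power_le_one[of "\<rho> / 2" m] by simp
    have pe: "\<epsilon> * p / 2 \<le> \<rho>"
    proof -
      have "(\<rho> / 2) ^ m \<le> (\<rho> / 2) ^ 1" using \<rho> \<rho>1 m by (intro power_decreasing) auto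
      then have "p \<le> \<rho>" using \<rho> by (simp add: p_def)
      moreover have "\<epsilon> * p \<le> 1 * p" using \<epsilon> p0 by (intro mult_right_mono) auto
      ultimately show ?thesis using p0 by linarith
    qed
    have MKs: "K ^ s * x \<le> M * K ^ s * x" if "x \<ge> 0" for x
      using that M K0 mult_right_mono[OF M, of "K ^ s * x"] by simp
    \<comment> \<open>Otherwise \<open>Z c\<close> as the part of \<open>a\<close>, together with
      the parts \<open>Y\<close> inside \<open>W'\<close>, contradicts \<open>nd\<close>. The parts
      are disjoint because \<open>Z c\<close> avoids \<open>W'\<close>, and the dense pair is
      \<open>(Z c, W')\<close>.\<close>
    have not_dense: "card (homs (insert a S) E R (Y(a := ?Z)))
      < \<epsilon> * p / 2 * (\<Prod>v\<in>insert a S. real (card ((Y(a := ?Z)) v)))"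
    proof (rule ccontr)
      assume "\<not> ?thesis"
      then have d1: "\<epsilon> * p / 2 * (\<Prod>v\<in>insert a S. real (card ((Y(a := ?Z)) v)))
        \<le> card (homs (insert a S) E (\<lambda>x y. \<chi> x y = c) (Y(a := ?Z)))" by (simp only: Rc not_less)
      have d2: "real (card W) \<le> M * K ^ s * card ?Z"
        using Zc(4) MKs[of "card ?Z"] by linarith
      have d3: "real (card W) \<le> M * K ^ s * card W'"
        using WW' MKs[of "card W'"] by linarith
      have d4: "\<epsilon> * p / 2 * card ?Z * card W' \<le> (\<Sum>x\<in>W'. real (card {y\<in>?Z. \<chi> x y = c}))"
      proof -
        have "\<epsilon> * p / 2 * card ?Z * card W' = (\<Sum>x\<in>W'. \<epsilon> * p / 2 * card ?Z)" by simp
        also have "\<dots> \<le> (\<Sum>x\<in>W'. real (card {y\<in>?Z. \<chi> x y = c}))"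
        proof (rule sum_mono)
          fix x assume x: "x \<in> W'"
          have "\<epsilon> * p / 2 * card ?Z \<le> \<sigma> * card ?Z"
            using pe \<sigma>\<rho> by (intro mult_right_mono) auto
          then show "\<epsilon> * p / 2 * card ?Z \<le> real (card {y\<in>?Z. \<chi> x y = c})"
            using deg[OF x] by (simp add: \<sigma>_def R_def)
        qed
        finally show ?thesis .
      qed
      have d5: "\<forall>v\<in>insert a S. (Y(a := ?Z)) v \<subseteq> W \<and> real (card W) \<le> M * K ^ s * card ((Y(a := ?Z)) v)"
      proof (intro ballI conjI)
        fix v assume v: "v \<in> insert a S"
        show "(Y(a := ?Z)) v \<subseteq> W" using v Y(1) W'sub Zc by auto
        show "real (card W) \<le> M * K ^ s * card ((Y(a := ?Z)) v)"
        proof (cases "v = a")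
          case True
          then show ?thesis using \<open>real (card W) \<le> M * K ^ s * card ?Z\<close> by simp
        next
          case False
          then have "K ^ s * card W' \<le> K ^ s * (M * card (Y v))"
            using v Y(2)[of v] K0 by (intro mult_left_mono) auto
          then show ?thesis using False WW' by (simp add: mult_ac)
        qed
      qed
      have YZ: "Y v \<inter> ?Z = {}" "?Z \<inter> Y v = {}" if "v \<in> S" for v using Y(1)[OF that] Zc(2) by auto
      have d6: "disjoint_family_on (Y(a := ?Z)) (insert a S)"
        using Yd YZ a unfolding disjoint_family_on_def by auto
      have "dense_colour (insert a S) E (\<epsilon> * p / 2) (M * K ^ s) q \<chi> W"
        by (rule dense_colourI[where c = c and X = ?Z and X' = W' and Y = "Y(a := ?Z)"])
          (fact c Zc W'sub d1 d2 d3 d4 d5 d6)+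
      then show False using nd by (simp add: p_def s_def)
    qed
    have "\<exists>\<omega>. (\<epsilon> / 2) * (\<Prod>j\<in>I. real (card (Y j))) \<le> (\<Prod>j\<in>I. real (card (common_nbrs J E R Y \<omega> j)))
      \<and> (\<Sum>z\<in>?Z. \<Prod>j\<in>I. real (card {y \<in> common_nbrs J E R Y \<omega> j. R z y}))
       < p * card ?Z * (\<Prod>j\<in>I. real (card (common_nbrs J E R Y \<omega> j)))"
      by (rule homs_insert_or_sparse_box[OF finS])
        (fact finY finZ a symE irr tf symR I_def J_def \<epsilon>(1) less_imp_le[OF p0] hom[unfolded Rc] not_dense)+
    then obtain \<omega> where \<omega>1: "(\<epsilon> / 2) * (\<Prod>j\<in>I. real (card (Y j))) \<le> (\<Prod>j\<in>I. real (card (common_nbrs J E R Y \<omega> j)))"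
      and \<omega>2: "(\<Sum>z\<in>?Z. \<Prod>j\<in>I. real (card {y \<in> common_nbrs J E R Y \<omega> j. R z y}))
       < p * card ?Z * (\<Prod>j\<in>I. real (card (common_nbrs J E R Y \<omega> j)))"
      by blast
    define D where "D = common_nbrs J E R Y \<omega>"
    have Dsub: "D j \<subseteq> Y j" for j by (auto simp: D_def common_nbrs_def)
    have I: "finite I" "I \<subseteq> S" using finS by (auto simp: I_def)
    have finD: "finite (D j)" if "j \<in> I" for j using Dsub[of j] finY[of j] I that finite_subset by blast
    have Yc: "real (card (Y j)) > 0" if "j \<in> I" for j
    proof -
      have "real (card W') \<le> M * card (Y j)" using Y(2) I that by auto
      then show ?thesis using cW' by (cases "card (Y j) = 0") auto
    qed
    have Dge: "\<epsilon> / 2 * card (Y j) \<le> card (D j)" if j: "j \<in> I" for j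
    proof (rule prod_ratio_factor[where x = "\<lambda>j. real (card (D j))" and y = "\<lambda>j. real (card (Y j))", OF I(1) _ _ _ j])
      fix i assume i: "i \<in> I"
      have "card (D i) \<le> card (Y i)" using finY[of i] i I Dsub by (intro card_mono) auto
      then show "0 \<le> real (card (D i)) \<and> real (card (D i)) \<le> real (card (Y i))" by simp
      show "0 < real (card (Y i))" using Yc[OF i] .
    next
      show "\<epsilon> / 2 * (\<Prod>i\<in>I. real (card (Y i))) \<le> (\<Prod>i\<in>I. real (card (D i)))"
        using \<omega>1 by (simp add: D_def)
    qed
    have Dne: "D j \<noteq> {}" if "j \<in> I" for j
    proof -
      have "\<epsilon> / 2 * card (Y j) > 0" using Yc[OF that] \<epsilon> by simp
      then show ?thesis using Dge[OF that] by auto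
    qed
    \<comment> \<open>\<open>p\<close> is built from the initial bound \<open>\<rho>\<close>; as
      \<open>\<sigma>\<close> is at least \<open>\<rho>\<close>, the box is also sparse at the level
      that \<open>density_increment\<close> needs.\<close>
    have "p \<le> (\<sigma> / 2) ^ m / 2" unfolding p_def using \<sigma>\<rho> \<rho> by (intro divide_right_mono power_mono) auto
    then have "p * (card ?Z * (\<Prod>j\<in>I. real (card (D j)))) \<le> (\<sigma> / 2) ^ m / 2 * (card ?Z * (\<Prod>j\<in>I. real (card (D j))))"
      by (intro mult_right_mono mult_nonneg_nonneg prod_nonneg) auto
    then have sparse: "(\<Sum>z\<in>?Z. \<Prod>j\<in>I. real (card {y\<in>D j. R z y}))
      < (\<sigma> / 2) ^ m / 2 * card ?Z * (\<Prod>j\<in>I. real (card (D j)))"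
      using \<omega>2 by (simp add: D_def mult.assoc)
    have "card I \<le> card S" using I finS by (intro card_mono) auto
    then have cI: "card I \<le> m" "1 \<le> m" using m by auto
    have \<sigma>0: "0 < \<sigma>" using \<sigma>\<rho> \<rho> by linarith
    have degD: "\<sigma> * card ?Z \<le> card {z\<in>?Z. R w z}" if "j \<in> I" "w \<in> D j" for j w
      unfolding \<sigma>_def using that Dsub[of j] Y(1)[of j] I by (intro deg) auto
    have "\<exists>j\<in>I. \<exists>Z'\<subseteq>?Z. \<exists>D'\<subseteq>D j. Z' \<noteq> {} \<and> \<sigma> / 2 * card ?Z \<le> card Z' \<and>
      \<sigma> / (8 * real m) * card (D j) \<le> card D' \<and>
      (\<forall>w\<in>D'. \<sigma> * (1 + 1 / (8 * real m)) * card Z' \<le> card {z\<in>Z'. R w z})"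
      by (rule density_increment[OF I(1) finZ])
        (fact finD Zc(3) Dne cI \<sigma>0 \<sigma>1 symR degD sparse)+
    then obtain j Z' D' where j: "j \<in> I" and Z': "Z' \<subseteq> ?Z" "Z' \<noteq> {}" "\<sigma> / 2 * card ?Z \<le> card Z'"
      and D': "D' \<subseteq> D j" "\<sigma> / (8 * real m) * card (D j) \<le> card D'"
      and deg': "\<And>w. w \<in> D' \<Longrightarrow> \<sigma> * (1 + 1 / (8 * real m)) * card Z' \<le> card {z\<in>Z'. R w z}"
      by (elim bexE exE conjE) blast
    have jS: "j \<in> S" using j I by auto
    \<comment> \<open>\<open>D'\<close> replaces \<open>W'\<close> and \<open>Z'\<close> replaces
      \<open>Z c\<close>. The size of \<open>D'\<close> is traced back through \<open>D j\<close>
      and \<open>Y j\<close> to \<open>W'\<close>.\<close>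
    have "real (card W') * (\<rho> * \<epsilon>) \<le> M * card (Y j) * (\<rho> * \<epsilon>)"
      using Y(2)[OF jS] \<rho> \<epsilon> by (intro mult_right_mono) auto
    also have "\<dots> = 16 * real m * M * (\<rho> / (8 * real m) * (\<epsilon> / 2 * card (Y j)))" using m1 by simp
    also have "\<dots> \<le> 16 * real m * M * (\<sigma> / (8 * real m) * card (D j))"
      using Dge[OF j] \<sigma>\<rho> \<rho> \<epsilon> M m1 by (intro mult_left_mono mult_mono divide_right_mono) auto
    also have "\<dots> \<le> 16 * real m * M * card D'" using D'(2) M m1 by (intro mult_left_mono) auto
    also have "\<dots> = (K * card D') * (\<rho> * \<epsilon>)" unfolding K16 by simp
    finally have "real (card W') * (\<rho> * \<epsilon>) \<le> (K * card D') * (\<rho> * \<epsilon>)" .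
    then have D'c: "real (card W') \<le> K * card D'" by (rule mult_right_le_imp_le) (use \<rho> \<epsilon> in simp)
    have "2 * real (card ?Z) \<le> K * \<rho> * card ?Z" using K\<rho> K\<rho>\<epsilon> by (intro mult_right_mono) auto
    also have "\<dots> \<le> K * \<sigma> * card ?Z" using \<sigma>\<rho> K0 by (intro mult_right_mono mult_left_mono) auto
    also have "\<dots> = 2 * (K * (\<sigma> / 2 * card ?Z))" by simp
    also have "\<dots> \<le> 2 * (K * card Z')" using Z'(3) K0 by (intro mult_left_mono) auto
    finally have "real (card ?Z) \<le> K * card Z'" by simp
    then have "K ^ s * card ?Z \<le> K ^ s * (K * card Z')" using K0 by (intro mult_left_mono) auto
    then have Z's: "real (card W) \<le> K ^ Suc s * card Z'" using Zc(4) by (simp add: mult_ac)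
    have D'W: "D' \<subseteq> W'" using D' Dsub[of j] Y(1)[OF jS] by auto
    \<comment> \<open>Here \<open>l c > 0\<close> matters: at 0 the truncated \<open>t - 1\<close>
      would gain no factor.\<close>
    have rS: "r (Suc (l c)) = \<sigma> * (1 + 1 / (8 * real m))"
      using False unfolding \<sigma>_def r by (cases "l c") auto
    show ?thesis
    proof (rule config_update[OF conf c K1 D'W D'c])
      show "Z' \<subseteq> W" using Z' Zc by auto
      show "Z' \<inter> D' = {}" using Z' Zc D'W by auto
      show "real (card W) \<le> K ^ Suc (\<Sum>c<q. l c) * card Z'" using Z's by (simp add: s_def)
      show "r (Suc (l c)) * card Z' \<le> card {z\<in>Z'. \<chi> w z = c}" if "w \<in> D'" for w
        using deg'[OF that] rS by (simp add: R_def)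
    qed (rule Z'(2))
  qed
qed


text \<open>A relative degree above 1 is impossible, which stops every colour after \<open>L\<close>
  increments.\<close>

lemma config_levels_le:
  assumes conf: "config q \<chi> r W K l Z W'" and finW: "finite W" and W': "W' \<noteq> {}"
    and r: "\<And>t. t \<ge> Suc L \<Longrightarrow> r t > 1"
  shows "(\<Sum>c<q. l c) \<le> q * L"
proof -
  have "l c \<le> L" if c: "c < q" for c
  proof (rule ccontr)
    assume "\<not> l c \<le> L"
    then have lc: "l c \<ge> Suc L" by simp
    then have Zc: "Z c \<subseteq> W" "Z c \<noteq> {}"
      and deg: "\<forall>w\<in>W'. r (l c) * card (Z c) \<le> card {z\<in>Z c. \<chi> w z = c}"
      using conf c by (simp_all add: config_def)
    obtain w where w: "w \<in> W'" using W' by auto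
    have finZ: "finite (Z c)" using Zc finW finite_subset by blast
    then have "card {z\<in>Z c. \<chi> w z = c} \<le> card (Z c)" by (intro card_mono) auto
    then have "r (l c) * card (Z c) \<le> 1 * real (card (Z c))" using deg w by force
    moreover have "real (card (Z c)) > 0" using finZ Zc by (simp add: card_gt_0_iff)
    ultimately show False using r[OF lc] by simp
  qed
  then have "(\<Sum>c<q. l c) \<le> (\<Sum>c<q. L)" by (intro sum_mono) auto
  then show ?thesis by simp
qed

text \<open>If no colour were dense for \<open>insert a S\<close>, the step could be repeated
  \<open>Suc (q * L)\<close> times, more than \<open>q\<close> colours with at most \<open>L\<close>
  levels each allow. \<open>W\<close> is so large that the host set keeps size at least
  \<open>M\<close> throughout, so the hypothesis for \<open>S\<close> always applies.\<close>

lemma dense_colour_insert: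
  fixes E :: "'a \<Rightarrow> 'a \<Rightarrow> bool" and \<chi> :: "'b \<Rightarrow> 'b \<Rightarrow> nat" and \<epsilon> \<rho> M K :: real
  assumes finS: "finite S" and a: "a \<notin> S"
    and symE: "\<And>u v. E u v \<Longrightarrow> E v u" and irr: "\<And>v. \<not> E v v"
    and tf: "\<And>x y z. E x y \<Longrightarrow> E y z \<Longrightarrow> \<not> E x z"
    and sym\<chi>: "\<And>x y. \<chi> x y = \<chi> y x" and finW: "finite W"
    and \<epsilon>: "0 < \<epsilon>" "\<epsilon> \<le> 1" and \<rho>: "0 < \<rho>" "\<rho> \<le> \<epsilon> / 2" and m: "m = Suc (card S)" and M: "M \<ge> 1"
    and K: "K = 16 * real m * M / (\<rho> * \<epsilon>)" and K1: "K \<ge> 1"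
    and L: "\<rho> * (1 + 1 / (8 * real m)) ^ L > 1"
    and IH: "\<And>W'. finite W' \<Longrightarrow> real (card W') \<ge> M \<Longrightarrow> dense_colour S E \<epsilon> M q \<chi> W'"
    and W: "M * K ^ Suc (q * L) \<le> card W"
  shows "dense_colour (insert a S) E (\<epsilon> * ((\<rho> / 2) ^ m / 2) / 2) (M * K ^ (q * L)) q \<chi> W"
proof (rule ccontr)
  assume nd: "\<not> ?thesis"
  define r where "r = (\<lambda>t. \<rho> * (1 + 1 / (8 * real m)) ^ (t - 1))"
  have r1: "r t > 1" if "t \<ge> Suc L" for t
  proof -
    have "(1 + 1 / (8 * real m)) ^ L \<le> (1 + 1 / (8 * real m)) ^ (t - 1)"
      using that by (intro power_increasing) auto
    then have "\<rho> * (1 + 1 / (8 * real m)) ^ L \<le> r t"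
      unfolding r_def using \<rho> by (intro mult_left_mono) auto
    then show ?thesis using L by linarith
  qed
  have big: "real (card W') \<ge> M" if conf: "config q \<chi> r W K l Z W'" and s: "(\<Sum>c<q. l c) \<le> Suc (q * L)" for l Z W'
  proof -
    have "K ^ (\<Sum>c<q. l c) * M \<le> M * K ^ Suc (q * L)"
      using M K1 s by (subst mult.commute, intro mult_left_mono power_increasing) auto
    also have "\<dots> \<le> K ^ (\<Sum>c<q. l c) * card W'"
      using W conf unfolding config_def by linarith
    finally show ?thesis by (rule mult_left_le_imp_le) (use K1 in simp)
  qed
  have ne: "W' \<noteq> {}" if "real (card W') \<ge> M" for W' :: "'b set" using that M by auto
  have "\<exists>l Z W'. config q \<chi> r W K l Z W' \<and> (\<Sum>c<q. l c) = s" if "s \<le> Suc (q * L)" for s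
    using that
  proof (induction s)
    case 0
    show ?case
      by (rule exI[of _ "\<lambda>_. 0"], rule exI[of _ "\<lambda>_. {}"], rule exI[of _ W]) (simp add: config_def)
  next
    case (Suc s)
    then obtain l Z W' where conf: "config q \<chi> r W K l Z W'" and s: "(\<Sum>c<q. l c) = s" by auto
    have W': "real (card W') \<ge> M" by (rule big[OF conf]) (use s Suc.prems in simp)
    have finW': "finite W'" using conf finW finite_subset unfolding config_def by blast
    \<comment> \<open>Non-density is assumed for the largest size loss and therefore holds for the
      smaller loss \<open>M * K ^ s\<close>.\<close>
    have "M * K ^ s \<le> M * K ^ (q * L)" using M K1 Suc.prems by (intro mult_left_mono power_increasing) auto
    then have nds: "\<not> dense_colour (insert a S) E (\<epsilon> * ((\<rho> / 2) ^ m / 2) / 2) (M * K ^ (\<Sum>c<q. l c)) q \<chi> W"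
      using nd dense_colour_mono[OF _ order.refl] unfolding s by blast
    show ?case
      unfolding s[symmetric]
      by (rule config_step[OF finS a])
        (fact symE irr tf sym\<chi> finW \<epsilon> \<rho> m M r_def K conf ne[OF W'] IH[OF finW' W'] nds)+
  qed
  then obtain l Z W' where conf: "config q \<chi> r W K l Z W'" and s: "(\<Sum>c<q. l c) = Suc (q * L)" by blast
  have "real (card W') \<ge> M" by (rule big[OF conf]) (simp add: s)
  then have "(\<Sum>c<q. l c) \<le> q * L" using config_levels_le[OF conf finW ne r1] by blast
  then show False using s by simp
qed

section \<open>Induction on the vertices with explicit exponents\<close>

text \<open>By Bernoulli, \<open>8 * m\<close> levels at least double the bound, so
  \<open>8 * m * Suc al * q\<close> levels multiply it by at least \<open>2 ^ (Suc al * q)\<close>,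
  which exceeds \<open>q ^ Suc al\<close>.\<close>

lemma level_bound_arith:
  assumes q: "q \<ge> 2" and m: "m \<ge> 1"
  shows "1 / real q ^ Suc al * (1 + 1 / (8 * real m)) ^ (8 * m * Suc al * q) > 1"
proof -
  have "1 + real (8 * m) * (1 / (8 * real m)) \<le> (1 + 1 / (8 * real m)) ^ (8 * m)"
    by (rule Bernoulli_inequality) (rule order_trans[of _ 0], simp_all)
  then have two: "2 \<le> (1 + 1 / (8 * real m)) ^ (8 * m)" using m by simp
  have "real q < 2 ^ q" by (rule of_nat_less_two_power)
  then have "real q ^ Suc al < (2 ^ q) ^ Suc al" using q by (intro power_strict_mono) auto
  also have "\<dots> = 2 ^ (Suc al * q)" by (simp only: power_mult[symmetric] mult.commute)
  also have "\<dots> \<le> ((1 + 1 / (8 * real m)) ^ (8 * m)) ^ (Suc al * q)" using two by (intro power_mono) auto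
  also have "\<dots> = (1 + 1 / (8 * real m)) ^ (8 * m * Suc al * q)" by (simp only: power_mult[symmetric] mult.assoc)
  finally show ?thesis using q by (simp add: field_simps)
qed

text \<open>Each new vertex multiplies the exponent of the size loss by a constant times
  \<open>q * L + 2\<close>, with \<open>L\<close> linear in \<open>q\<close>; this is the origin of
  \<open>q ^ (2 * card S)\<close>. The density stays a fixed power of \<open>1 / q\<close>.\<close>

lemma exists_dense_colour:
  fixes E :: "'a \<Rightarrow> 'a \<Rightarrow> bool"
  assumes symE: "\<And>u v. E u v \<Longrightarrow> E v u" and irr: "\<And>v. \<not> E v v"
    and tf: "\<And>x y z. E x y \<Longrightarrow> E y z \<Longrightarrow> \<not> E x z"
  shows "finite S \<Longrightarrow> \<exists>al be::nat. \<forall>q\<ge>2. \<forall>\<chi>::'b \<Rightarrow> 'b \<Rightarrow> nat. (\<forall>x y. \<chi> x y = \<chi> y x \<and> \<chi> x y < q) \<longrightarrow>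
    (\<forall>W. finite W \<longrightarrow> real (card W) \<ge> real q ^ (be * q ^ (2 * card S)) \<longrightarrow>
      dense_colour S E (1 / real q ^ al) (real q ^ (be * q ^ (2 * card S))) q \<chi> W)"
proof (induction S rule: finite_induct)
  case empty
  show ?case
  proof (rule exI[of _ 1], rule exI[of _ 2], intro allI impI)
    fix q :: nat and \<chi> :: "'b \<Rightarrow> 'b \<Rightarrow> nat" and W :: "'b set"
    assume q: "2 \<le> q" and \<chi>: "\<forall>x y. \<chi> x y = \<chi> y x \<and> \<chi> x y < q" and W: "finite W"
      and cW: "real (card W) \<ge> real q ^ (2 * q ^ (2 * card ({}::'a set)))"
    have "2 ^ 2 \<le> real q ^ 2" using q by (intro power_mono) auto
    then have q4: "4 \<le> real q ^ 2" by simp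
    have "2 ^ 2 \<le> q ^ 2" using q by (intro power_mono) auto
    then have "card W \<ge> 4" using cW by simp
    then have "dense_colour {} E (1 / real q) 4 q \<chi> W" using W q \<chi> by (intro dense_colour_empty) auto
    then show "dense_colour {} E (1 / real q ^ 1) (real q ^ (2 * q ^ (2 * card ({}::'a set)))) q \<chi> W"
      by (rule dense_colour_mono) (use q4 in simp_all)
  qed
next
  case (insert a S)
  from insert.IH obtain al be where dense: "\<forall>q\<ge>2. \<forall>\<chi>::'b \<Rightarrow> 'b \<Rightarrow> nat. (\<forall>x y. \<chi> x y = \<chi> y x \<and> \<chi> x y < q) \<longrightarrow>
    (\<forall>W. finite W \<longrightarrow> real (card W) \<ge> real q ^ (be * q ^ (2 * card S)) \<longrightarrow>
      dense_colour S E (1 / real q ^ al) (real q ^ (be * q ^ (2 * card S))) q \<chi> W)"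
    by (elim exE) (rule that)
  have IH: "dense_colour S E (1 / real q ^ al) (real q ^ (be * q ^ (2 * card S))) q \<chi> W"
    if "2 \<le> q" "\<forall>x y. \<chi> x y = \<chi> y x \<and> \<chi> x y < q" "finite W"
      "real q ^ (be * q ^ (2 * card S)) \<le> real (card W)" for q and \<chi> :: "'b \<Rightarrow> 'b \<Rightarrow> nat" and W
    by (rule dense[THEN spec, THEN mp, THEN spec, THEN mp, THEN spec, THEN mp, THEN mp]) (fact that)+
  define m where "m = Suc (card S)"
  \<comment> \<open>The summands bound the factors of \<open>K\<close>:
    \<open>16 \<le> q ^ 4\<close>, \<open>m \<le> q ^ m\<close>, and
    \<open>1 / (\<rho> * \<epsilon>) = q ^ Suc (2 * al)\<close>.\<close>
  define C where "C = 4 + m + Suc (2 * al)"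
  \<comment> \<open>\<open>al\<close> comes from \<open>\<epsilon>\<close>,
    \<open>(al + 2) * m\<close> from \<open>(\<rho> / 2) ^ m\<close>, and 2 from the remaining
    factor \<open>1 / 4\<close>.\<close>
  define al' where "al' = al + (al + 2) * m + 2"
  define be' where "be' = (C + be) * (8 * m * Suc al + 2)"
  have m1: "real m \<ge> 1" by (simp add: m_def)
  show ?case
  proof (rule exI[of _ al'], rule exI[of _ be'], intro allI impI)
    fix q :: nat and \<chi> :: "'b \<Rightarrow> 'b \<Rightarrow> nat" and W :: "'b set"
    assume q: "2 \<le> q" and \<chi>: "\<forall>x y. \<chi> x y = \<chi> y x \<and> \<chi> x y < q" and W: "finite W"
      and cW: "real (card W) \<ge> real q ^ (be' * q ^ (2 * card (insert a S)))"
    have q1: "real q \<ge> 1" "real q \<ge> 2" "real q > 0" using q by auto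
    define \<epsilon> where "\<epsilon> = 1 / real q ^ al"
    \<comment> \<open>One more power of \<open>q\<close> than in \<open>\<epsilon>\<close> gives
      \<open>\<rho> \<le> \<epsilon> / 2\<close>, because \<open>q \<ge> 2\<close>.\<close>
    define \<rho> where "\<rho> = 1 / real q ^ Suc al"
    define M where "M = real q ^ (be * q ^ (2 * card S))"
    define K where "K = 16 * real m * M / (\<rho> * \<epsilon>)"
    define L where "L = 8 * m * Suc al * q"
    have \<epsilon>: "0 < \<epsilon>" "\<epsilon> \<le> 1" using q1 by (simp_all add: \<epsilon>_def)
    have \<rho>0: "0 < \<rho>" using q1 by (simp add: \<rho>_def)
    have \<rho>: "\<rho> \<le> \<epsilon> / 2" using q1 by (simp add: \<rho>_def \<epsilon>_def field_simps)
    have M1: "M \<ge> 1" using q1 by (simp add: M_def)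
    have Keq: "K = 16 * real m * M * real q ^ Suc (2 * al)"
      using q1 by (simp add: K_def \<rho>_def \<epsilon>_def power_add[symmetric] mult_2 algebra_simps)
    have pw: "real q ^ Suc (2 * al) \<ge> 1" using q1 by (intro one_le_power) auto
    have "1 * 1 * M * 1 \<le> K" unfolding Keq using m1 M1 pw by (intro mult_mono) auto
    then have MK: "M \<le> K" by simp
    then have K1: "K \<ge> 1" using M1 by linarith
    have "2 ^ 4 \<le> real q ^ 4" using q1 by (intro power_mono) auto
    then have q16: "16 \<le> real q ^ 4" by simp
    have "real m \<le> 2 ^ m" using of_nat_less_two_power[of m, where 'a=real] by linarith
    also have "\<dots> \<le> real q ^ m" using q1 by (intro power_mono) auto
    finally have mq: "real m \<le> real q ^ m" .
    have "K \<le> real q ^ 4 * real q ^ m * M * real q ^ Suc (2 * al)"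
      unfolding Keq using q16 mq M1 by (intro mult_mono) auto
    also have "\<dots> = real q ^ (C + be * q ^ (2 * card S))"
      by (simp only: M_def C_def power_add mult_ac)
    also have "\<dots> \<le> real q ^ ((C + be) * q ^ (2 * card S))"
    proof (rule power_increasing)
      have "1 \<le> q ^ (2 * card S)" using q by simp
      then have "C * 1 \<le> C * q ^ (2 * card S)" by (intro mult_le_mono2)
      then show "C + be * q ^ (2 * card S) \<le> (C + be) * q ^ (2 * card S)" by (simp add: algebra_simps)
    qed (use q1 in simp)
    finally have Kq: "K \<le> real q ^ ((C + be) * q ^ (2 * card S))" .
    \<comment> \<open>The total loss is at most \<open>K ^ (q * L + 2)\<close>, since the outer
      \<open>M\<close> is bounded by \<open>K\<close>; and \<open>q * L\<close> is quadratic in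
      \<open>q\<close>.\<close>
    have exp_le: "(C + be) * q ^ (2 * card S) * (q * L + 2) \<le> be' * q ^ (2 * card (insert a S))"
    proof -
      have "1 * 1 \<le> q * q" using q by (intro mult_le_mono) auto
      then have "q * L + 2 \<le> (8 * m * Suc al + 2) * (q * q)"
        unfolding L_def by (simp add: algebra_simps)
      then have "(C + be) * q ^ (2 * card S) * (q * L + 2)
          \<le> (C + be) * q ^ (2 * card S) * ((8 * m * Suc al + 2) * (q * q))" by (rule mult_le_mono2)
      also have "\<dots> = be' * q ^ (2 * card (insert a S))"
        unfolding be'_def card_insert_disjoint[OF insert.hyps] mult_Suc_right power_add power2_eq_square
        by (simp only: mult_ac)
      finally show ?thesis .
    qed
    have "M * K ^ Suc (q * L) \<le> K * K ^ Suc (q * L)" using MK K1 by (intro mult_right_mono) auto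
    also have "\<dots> = K ^ (q * L + 2)" by simp
    also have "\<dots> \<le> (real q ^ ((C + be) * q ^ (2 * card S))) ^ (q * L + 2)"
      using Kq K1 by (intro power_mono) auto
    also have "\<dots> = real q ^ ((C + be) * q ^ (2 * card S) * (q * L + 2))" by (simp only: power_mult)
    also have "\<dots> \<le> real q ^ (be' * q ^ (2 * card (insert a S)))"
      using q1 exp_le by (intro power_increasing)
    finally have sizes: "M * K ^ Suc (q * L) \<le> real q ^ (be' * q ^ (2 * card (insert a S)))" .
    have Wbig: "M * K ^ Suc (q * L) \<le> card W" using sizes cW by linarith
    have Lgt: "\<rho> * (1 + 1 / (8 * real m)) ^ L > 1"
      unfolding \<rho>_def L_def by (rule level_bound_arith[OF q]) (simp add: m_def)
    have sym\<chi>: "\<And>x y. \<chi> x y = \<chi> y x" using \<chi> by blast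
    have IH': "\<And>W'. finite W' \<Longrightarrow> real (card W') \<ge> M \<Longrightarrow> dense_colour S E \<epsilon> M q \<chi> W'"
      unfolding \<epsilon>_def M_def by (rule IH[OF q \<chi>])
    have dense: "dense_colour (insert a S) E (\<epsilon> * ((\<rho> / 2) ^ m / 2) / 2) (M * K ^ (q * L)) q \<chi> W"
      by (rule dense_colour_insert[OF insert.hyps])
        (fact symE irr tf sym\<chi> W \<epsilon> \<rho>0 \<rho> m_def M1 K_def K1 Lgt IH' Wbig)+
    have "1 / real q ^ (al + 2) \<le> \<rho> / 2" using q1 by (simp add: \<rho>_def field_simps)
    then have "(1 / real q ^ (al + 2)) ^ m \<le> (\<rho> / 2) ^ m" using q1 by (intro power_mono) auto
    then have pm: "1 / real q ^ ((al + 2) * m) \<le> (\<rho> / 2) ^ m" by (simp only: power_divide power_one power_mult)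
    have "2 ^ 2 \<le> real q ^ 2" using q1 by (intro power_mono) auto
    then have q4: "1 / real q ^ 2 \<le> 1 / 4" using q1 by (simp add: field_simps)
    have "1 / real q ^ al' = \<epsilon> * (1 / real q ^ ((al + 2) * m) * (1 / real q ^ 2))"
      by (simp add: al'_def \<epsilon>_def power_add power2_eq_square)
    also have "\<dots> \<le> \<epsilon> * ((\<rho> / 2) ^ m * (1 / 4))"
      using pm q4 \<epsilon> \<rho>0 q1 by (intro mult_left_mono mult_mono) auto
    also have "\<dots> = \<epsilon> * ((\<rho> / 2) ^ m / 2) / 2" by simp
    finally have \<epsilon>': "1 / real q ^ al' \<le> \<epsilon> * ((\<rho> / 2) ^ m / 2) / 2" .
    have "M * K ^ (q * L) \<le> M * K ^ Suc (q * L)" using M1 K1 by (intro mult_left_mono power_increasing) auto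
    then have "M * K ^ (q * L) \<le> real q ^ (be' * q ^ (2 * card (insert a S)))" using sizes by linarith
    then show "dense_colour (insert a S) E (1 / real q ^ al') (real q ^ (be' * q ^ (2 * card (insert a S)))) q \<chi> W"
      by (rule dense_colour_mono[OF dense \<epsilon>'])
  qed
qed

section \<open>The Ramsey bound\<close>

lemma mono_copy_blowup:
  assumes A: "\<And>v. v \<in> V \<Longrightarrow> A v \<subseteq> {..<N} \<and> card (A v) = k" and disj: "disjoint_family_on A V"
    and col: "\<And>u v x y. u \<in> V \<Longrightarrow> v \<in> V \<Longrightarrow> E u v \<Longrightarrow> x \<in> A u \<Longrightarrow> y \<in> A v \<Longrightarrow> c x y = d"
  shows "mono_copy (blowup_vertices V k) (blowup_edges E k) N c"
proof -
  have "\<exists>e. bij_betw e {..<k} (A v)" if "v \<in> V" for v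
  proof -
    have "finite (A v)" using A[OF that] finite_subset by blast
    then show ?thesis using ex_bij_betw_nat_finite A[OF that] by (metis atLeast0LessThan)
  qed
  then have "\<exists>e. \<forall>v\<in>V. bij_betw (e v) {..<k} (A v)" by (intro bchoice ballI)
  then obtain e where e: "\<And>v. v \<in> V \<Longrightarrow> bij_betw (e v) {..<k} (A v)" by (elim exE) (rule that, blast)
  have mem: "e v i \<in> A v" if "v \<in> V" "i < k" for v i using e[OF that(1)] that by (auto simp: bij_betw_def)
  define f where "f p = e (fst p) (snd p)" for p
  have "inj_on f (blowup_vertices V k)"
  proof (rule inj_onI)
    fix p p' assume p: "p \<in> blowup_vertices V k" and p': "p' \<in> blowup_vertices V k" and eq: "f p = f p'"
    then have V: "fst p \<in> V" "snd p < k" "fst p' \<in> V" "snd p' < k" by (auto simp: blowup_vertices_def)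
    have "f p \<in> A (fst p) \<inter> A (fst p')" using eq mem[OF V(1,2)] mem[OF V(3,4)] by (simp add: f_def)
    then have fst: "fst p = fst p'" using disj V by (auto simp: disjoint_family_on_def)
    have "inj_on (e (fst p)) {..<k}" using e[OF V(1)] by (simp add: bij_betw_def)
    moreover have "e (fst p) (snd p) = e (fst p) (snd p')" using eq fst by (simp add: f_def)
    ultimately have "snd p = snd p'" using V by (auto dest: inj_onD)
    then show "p = p'" using fst by (simp add: prod_eq_iff)
  qed
  moreover have "f ` blowup_vertices V k \<subseteq> {..<N}"
  proof (rule image_subsetI)
    fix p assume "p \<in> blowup_vertices V k"
    then have "fst p \<in> V" "snd p < k" by (auto simp: blowup_vertices_def)
    then show "f p \<in> {..<N}" unfolding f_def using mem A by blast
  qed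
  moreover have "c (f x) (f y) = d"
    if "x \<in> blowup_vertices V k" "y \<in> blowup_vertices V k" "blowup_edges E k x y" for x y
  proof -
    have "fst x \<in> V" "fst y \<in> V" "E (fst x) (fst y)" "snd x < k" "snd y < k"
      using that by (auto simp: blowup_vertices_def blowup_edges_def)
    then show ?thesis unfolding f_def by (intro col[of "fst x" "fst y"] mem)
  qed
  ultimately show ?thesis
    unfolding mono_copy_def by (intro exI[of _ f] exI[of _ d] conjI ballI impI)
qed

theorem theorem1p3:
  fixes V :: "'a set" and E :: "'a \<Rightarrow> 'a \<Rightarrow> bool"
  assumes "simple_graph V E" and "triangle_free V E"
  shows "\<exists>\<Lambda>::real. \<Lambda> > 0 \<and>
           (\<forall>q k :: nat. q \<ge> 2 \<longrightarrow>
              real k \<ge> 100 ^ card V * real q ^ (4 * (card V)\<^sup>2) \<longrightarrow>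
              real (ramsey_number (blowup_vertices V k) (blowup_edges E k) q)
                \<le> real q powr (\<Lambda> * real k))"
proof -
  define h where "h = card V"
  have finV: "finite V" and symE: "\<And>u v. E u v \<Longrightarrow> E v u" and irr: "\<And>v. \<not> E v v"
    and inV: "\<And>u v. E u v \<Longrightarrow> u \<in> V \<and> v \<in> V"
    using assms(1) unfolding simple_graph_def by blast+
  have tf: "\<And>x y z. E x y \<Longrightarrow> E y z \<Longrightarrow> \<not> E x z"
    using assms(2) inV unfolding triangle_free_def by blast
  have "\<exists>al be::nat. \<forall>q\<ge>2. \<forall>\<chi>::nat \<Rightarrow> nat \<Rightarrow> nat. (\<forall>x y. \<chi> x y = \<chi> y x \<and> \<chi> x y < q) \<longrightarrow>
    (\<forall>W. finite W \<longrightarrow> real (card W) \<ge> real q ^ (be * q ^ (2 * card V)) \<longrightarrow>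
      dense_colour V E (1 / real q ^ al) (real q ^ (be * q ^ (2 * card V))) q \<chi> W)"
    by (rule exists_dense_colour) (fact symE irr tf finV)+
  then obtain al be :: nat where thr: "\<forall>q\<ge>2. \<forall>\<chi>::nat \<Rightarrow> nat \<Rightarrow> nat. (\<forall>x y. \<chi> x y = \<chi> y x \<and> \<chi> x y < q) \<longrightarrow>
    (\<forall>W. finite W \<longrightarrow> real (card W) \<ge> real q ^ (be * q ^ (2 * card V)) \<longrightarrow>
      dense_colour V E (1 / real q ^ al) (real q ^ (be * q ^ (2 * card V))) q \<chi> W)"
    by (elim exE) (rule that)
  have dense: "dense_colour V E (1 / real q ^ al) (real q ^ (be * q ^ (2 * h))) q \<chi> W"
    if "2 \<le> q" "\<forall>x y. \<chi> x y = \<chi> y x \<and> \<chi> x y < q" "finite W"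
      "real q ^ (be * q ^ (2 * h)) \<le> real (card W)" for q and \<chi> :: "nat \<Rightarrow> nat \<Rightarrow> nat" and W
    unfolding h_def
    by (rule thr[THEN spec, THEN mp, THEN spec, THEN mp, THEN spec, THEN mp, THEN mp]) (fact that[unfolded h_def])+
  \<comment> \<open>\<open>16 ^ h * q ^ al\<close> is at most \<open>q ^ (4 * h + al)\<close>, and
    \<open>blowup_from_hom_density\<close> asks for its power \<open>2 * (h + 1) * k\<close>; the
    resulting exponent is \<open>e * k\<close>.\<close>
  define e where "e = (4 * h + al) * (2 * (h + 1))"
  \<comment> \<open>\<open>be\<close> pays for the loss in part size, \<open>e\<close> for the
    blowup, and 1 makes the constant positive.\<close>
  define \<Lambda> where "\<Lambda> = be + e + 1"
  show ?thesis
  proof (intro exI[of _ "real \<Lambda>"] conjI allI impI)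
    show "real \<Lambda> > 0" by (simp add: \<Lambda>_def)
    fix q k :: nat
    assume q: "2 \<le> q" and k: "100 ^ card V * real q ^ (4 * (card V)\<^sup>2) \<le> real k"
    have q1: "real q \<ge> 1" "real q \<ge> 2" "real q > 0" using q by auto
    \<comment> \<open>The lower bound on \<open>k\<close> enters here:
      \<open>q ^ (2 * h) \<le> k\<close> turns the loss \<open>q ^ (be * q ^ (2 * h))\<close> into
      at most \<open>q ^ (be * k)\<close>.\<close>
    have "2 * h \<le> 4 * h\<^sup>2" by (cases h) (auto simp: power2_eq_square)
    then have "real q ^ (2 * h) \<le> real q ^ (4 * h\<^sup>2)" using q1 by (intro power_increasing) auto
    also have "\<dots> \<le> 100 ^ h * real q ^ (4 * h\<^sup>2)"
      using q1 by (subst mult_le_cancel_right1) (simp add: not_less)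
    also have "\<dots> \<le> real k" using k unfolding h_def .
    finally have "real q ^ (2 * h) \<le> real k" .
    then have kq: "q ^ (2 * h) \<le> k" by (simp only: of_nat_power[symmetric] of_nat_le_iff)
    have "1 \<le> q ^ (2 * h)" using q by simp
    then have k1: "k \<ge> 1" using kq by linarith
    define N where "N = q ^ (\<Lambda> * k)"
    define M where "M = real q ^ (be * q ^ (2 * h))"
    have M0: "M > 0" using q1 by (simp add: M_def)
    have Mk: "M \<le> real q ^ (be * k)"
      unfolding M_def using q1 kq by (intro power_increasing mult_le_mono2) auto
    have Nk: "M * real q ^ (e * k) \<le> N"
    proof -
      have "M * real q ^ (e * k) \<le> real q ^ (be * k) * real q ^ (e * k)"
        using Mk by (intro mult_right_mono) auto
      also have "\<dots> = real q ^ ((be + e) * k)" by (simp only: power_add[symmetric] distrib_right)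
      also have "\<dots> \<le> real q ^ (\<Lambda> * k)"
        using q1 by (intro power_increasing mult_le_mono1) (auto simp: \<Lambda>_def)
      finally show ?thesis by (simp add: N_def)
    qed
    have "1 \<le> real q ^ (e * k)" using q1 by (intro one_le_power) auto
    then have "M * 1 \<le> M * real q ^ (e * k)" using M0 by (intro mult_left_mono) auto
    then have NM: "M \<le> N" using Nk by linarith
    have "mono_copy (blowup_vertices V k) (blowup_edges E k) N c" if colouring: "edge_colouring N q c" for c
    proof -
      \<comment> \<open>The colouring is extended by 0 to all other pairs, including the diagonal,
        so that symmetry and the bound by \<open>q\<close> hold everywhere.\<close>
      define \<chi> where "\<chi> x y = (if x < N \<and> y < N \<and> x \<noteq> y then c x y else 0)" for x y
      have \<chi>: "\<forall>x y. \<chi> x y = \<chi> y x \<and> \<chi> x y < q"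
        using colouring q by (auto simp: \<chi>_def edge_colouring_def)
      have "dense_colour V E (1 / real q ^ al) M q \<chi> {..<N}"
        unfolding M_def by (rule dense[OF q \<chi>]) (use NM in \<open>simp_all add: M_def\<close>)
      then obtain d Y where Y: "\<forall>v\<in>V. Y v \<subseteq> {..<N} \<and> real (card {..<N}) \<le> M * card (Y v)"
        and disj: "disjoint_family_on Y V"
        and hom: "1 / real q ^ al * (\<Prod>v\<in>V. real (card (Y v))) \<le> real (card (homs V E (\<lambda>x y. \<chi> x y = d) Y))"
        unfolding dense_colour_def by blast
      have Yk: "finite (Y v) \<and> (16 ^ h / (1 / real q ^ al)) ^ (2 * (h + 1) * k) \<le> real (card (Y v))"
        if v: "v \<in> V" for v
      proof
        show "finite (Y v)" using Y v finite_subset by blast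
        have "M * real q ^ (e * k) \<le> M * card (Y v)" using Nk Y v by fastforce
        then have "real q ^ (e * k) \<le> card (Y v)" using M0 by (rule mult_left_le_imp_le)
        moreover have "(16 ^ h / (1 / real q ^ al)) ^ (2 * (h + 1) * k) \<le> real q ^ (e * k)"
        proof -
          have "2 ^ (4 * h) \<le> real q ^ (4 * h)" using q1 by (intro power_mono) auto
          then have "16 ^ h \<le> real q ^ (4 * h)" by (simp add: power_mult)
          then have "16 ^ h * real q ^ al \<le> real q ^ (4 * h) * real q ^ al"
            using q1 by (intro mult_right_mono) auto
          then have "16 ^ h / (1 / real q ^ al) \<le> real q ^ (4 * h + al)" by (simp add: power_add)
          then have "(16 ^ h / (1 / real q ^ al)) ^ (2 * (h + 1) * k) \<le> (real q ^ (4 * h + al)) ^ (2 * (h + 1) * k)"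
            by (rule power_mono) simp
          also have "\<dots> = real q ^ (e * k)" by (simp only: e_def power_mult[symmetric] mult.assoc)
          finally show ?thesis .
        qed
        ultimately show "(16 ^ h / (1 / real q ^ al)) ^ (2 * (h + 1) * k) \<le> real (card (Y v))" by linarith
      qed
      have "\<exists>A. (\<forall>v\<in>V. A v \<subseteq> Y v \<and> card (A v) = k) \<and>
          (\<forall>u\<in>V. \<forall>v\<in>V. E u v \<longrightarrow> (\<forall>x\<in>A u. \<forall>y\<in>A v. \<chi> x y = d))"
      proof (rule blowup_from_hom_density[where n = h and g = "1 / real q ^ al"])
        show "\<chi> y x = d" if "\<chi> x y = d" for x y using that \<chi> by simp
        show "1 / real q ^ al \<le> 1" "0 < 1 / real q ^ al" using q1 by simp_all
      qed (fact symE irr tf k1 finV h_def[symmetric] Yk hom)+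
      then obtain A where A: "\<forall>v\<in>V. A v \<subseteq> Y v \<and> card (A v) = k"
        and AE: "\<forall>u\<in>V. \<forall>v\<in>V. E u v \<longrightarrow> (\<forall>x\<in>A u. \<forall>y\<in>A v. \<chi> x y = d)" by blast
      have disjA: "disjoint_family_on A V" using disj A by (fastforce simp: disjoint_family_on_def)
      have AN: "A v \<subseteq> {..<N} \<and> card (A v) = k" if "v \<in> V" for v using A Y that by blast
      show ?thesis
      proof (rule mono_copy_blowup[OF AN disjA])
        fix u v x y assume *: "u \<in> V" "v \<in> V" "E u v" "x \<in> A u" "y \<in> A v"
        \<comment> \<open>Adjacent vertices have disjoint parts, so the pair is off the diagonal,
          where \<open>\<chi>\<close> agrees with \<open>c\<close>.\<close>
        then have "u \<noteq> v" using irr by auto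
        then have "x \<noteq> y" using disjA * by (auto simp: disjoint_family_on_def)
        moreover have "x < N" "y < N" using AN * by auto
        moreover have "\<chi> x y = d" using AE * by blast
        ultimately show "c x y = d" by (simp add: \<chi>_def)
      qed
    qed
    then have "ramsey_number (blowup_vertices V k) (blowup_edges E k) q \<le> N"
      unfolding ramsey_number_def by (intro Least_le) auto
    then have "real (ramsey_number (blowup_vertices V k) (blowup_edges E k) q) \<le> real q ^ (\<Lambda> * k)"
      by (metis N_def of_nat_le_iff of_nat_power)
    also have "\<dots> = real q powr (real \<Lambda> * real k)" using q1 by (simp add: powr_realpow flip: of_nat_mult)
    finally show "real (ramsey_number (blowup_vertices V k) (blowup_edges E k) q) \<le> real q powr (real \<Lambda> * real k)" .
  qed
qed

end
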